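(* Let $D$ be a bounded domain in $\mathbb{C}^k$ and suppose $(D, K_D)$ is a proper geodesic Gromov hyperbolic metric space. Let $\Omega\subset \mathbb{C}^d$ be a Goldilocks domain. If $F :(D, K_D) \rightarrow (\Omega, K_\Omega)$ is a continuous quasi-isometric embedding, then there exists a continuous extension $\widetilde{F} : D \cup D(\infty) \rightarrow \overline{\Omega}$ of $F$, where $D(\infty)$ is the Gromov boundary of $(D,K_D)$.
   Context: For a bounded domain $\Omega \subset \mathbb{C}^d$: $K_\Omega$ is the Kobayashi distance on $\Omega$; $k_\Omega(x;v)$ ($x\in\Omega$, $v\in\mathbb{C}^d$) is the infinitesimal Kobayashi (Kobayashi--Royden) metric (normalised so that on the unit disc $\Delta\subset\mathbb{C}$ one has $k_\Delta(\zeta;1)=1/(1-|\zeta|^2)$ and $K_\Delta$ is the corresponding Poincaré distance); $\|\cdot\|$ is the Euclidean norm; $\delta_\Omega(x)$ is the Euclidean distance from $x$ to $\partial\Omega$. Define $$M_\Omega(r) := \sup\left\{ \frac{1}{k_{\Omega}(x;v)} : \delta_\Omega(x) \leq r, \|v\|=1\right\}.$$ A bounded domain $\Omega \subset \mathbb{C}^d$ is a Goldilocks domain if (1) for some (hence any) $\epsilon >0$, $\int_0^\epsilon \frac{1}{r} M_\Omega(r)\, dr < \infty$; and (2) for each $x_0 \in \Omega$ there exist constants $C, \alpha > 0$ (depending on $x_0$) such that $K_\Omega(x_0, x) \leq C + \alpha \log \frac{1}{\delta_\Omega(x)}$ for all $x \in \Omega$. A map $F:(X,d_X)\to(Y,d_Y)$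 between metric spaces is a quasi-isometric embedding if there exist $\lambda\ge1$, $\kappa\ge0$ with $\frac1\lambda d_Y(F(x_1),F(x_2))-\kappa\le d_X(x_1,x_2)\le\lambda d_Y(F(x_1),F(x_2))+\kappa$ for all $x_1,x_2\in X$. A metric space is proper if every bounded set is relatively compact. For a proper geodesic Gromov hyperbolic metric space $(X,d)$, the Gromov product is $(x|y)_o=\frac12(d(x,o)+d(o,y)-d(x,y))$. A sequence $(x_n)$ in $X$ converges at $\infty$ if $\liminf_{n,m\to\infty}(x_n|x_m)_o=\infty$ for some (hence any) $o\in X$; two such sequences $(x_n),(y_n)$ are equivalent if $\liminf_{n,m\to\infty}(x_n|y_m)_o=\infty$. The Gromov boundary $X(\infty)$ is the set of equivalence classes of sequences converging at $\infty$, and $X\cup X(\infty)$ carries its standard topology, which makes it a compactification of $X$ (the Gromov compactification). *)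

theory Defs
  imports "HOL-Analysis.Analysis"
begin

section \<open>The Kobayashi metric and the Kobayashi distance\<close>

definition bounded_domain :: "(complex ^ 'n) set \<Rightarrow> bool" where
  "bounded_domain \<Omega> \<longleftrightarrow> \<Omega> \<noteq> {} \<and> open \<Omega> \<and> connected \<Omega> \<and> bounded \<Omega>"

definition holomorphic_discs :: "(complex ^ 'n) set \<Rightarrow> (complex \<Rightarrow> complex ^ 'n) set" where
  "holomorphic_discs \<Omega> =
     {\<phi>. (\<forall>i. (\<lambda>z. \<phi> z $ i) holomorphic_on ball 0 1) \<and> \<phi> ` ball 0 1 \<subseteq> \<Omega>}"

text \<open>Infinitesimal Kobayashi (Kobayashi--Royden) metric: the infimum of the \<open>\<bar>\<xi>\<bar>\<close> such that
  \<open>\<phi>(0) = x\<close> and \<open>\<phi>'(0) \<xi> = v\<close> for a holomorphic disc \<open>\<phi>\<close>. Only meant for \<open>x \<in> \<Omega>\<close> with \<open>\<Omega>\<close> open;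
  the set is then nonempty.\<close>

definition kobayashi_metric :: "(complex ^ 'n) set \<Rightarrow> complex ^ 'n \<Rightarrow> complex ^ 'n \<Rightarrow> real" where
  "kobayashi_metric \<Omega> x v =
     Inf {norm \<xi> | \<xi> \<phi>. \<phi> \<in> holomorphic_discs \<Omega> \<and> \<phi> 0 = x \<and>
                        \<xi> *s (\<chi> i. deriv (\<lambda>z. \<phi> z $ i) 0) = v}"

text \<open>The Poincare distance of the unit disc, for the metric \<open>\<bar>d\<zeta>\<bar> / (1 - \<bar>\<zeta>\<bar>\<^sup>2)\<close>.\<close>

definition poincare_dist :: "complex \<Rightarrow> complex \<Rightarrow> real" where
  "poincare_dist a b = artanh (norm ((a - b) / (1 - cnj a * b)))"

text \<open>Kobayashi's definition by chains of holomorphic discs: \<open>p 0 = x, \<dots>, p n = y\<close> are the nodes of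
  a chain and \<open>\<phi> j\<close> maps \<open>a j\<close>, \<open>b j\<close> to \<open>p j\<close>, \<open>p (j + 1)\<close>. The value \<open>0\<close> off \<open>\<Omega>\<close> is a mere
  convention: \<^const>\<open>Metric_space\<close> requires symmetry and nonnegativity also outside the carrier.\<close>

definition kobayashi_dist :: "(complex ^ 'n) set \<Rightarrow> complex ^ 'n \<Rightarrow> complex ^ 'n \<Rightarrow> real" where
  "kobayashi_dist \<Omega> x y =
     (if x \<in> \<Omega> \<and> y \<in> \<Omega> then
        Inf {\<Sum>j<n. poincare_dist (a j) (b j) | n p \<phi> a b.
               p 0 = x \<and> p n = y \<and>
               (\<forall>j<n. \<phi> j \<in> holomorphic_discs \<Omega> \<and> a j \<in> ball 0 1 \<and> b j \<in> ball 0 1 \<and>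
                      \<phi> j (a j) = p j \<and> \<phi> j (b j) = p (Suc j))}
      else 0)"


section \<open>Goldilocks domains\<close>

definition boundary_dist :: "(complex ^ 'n) set \<Rightarrow> complex ^ 'n \<Rightarrow> real" where
  "boundary_dist \<Omega> x = infdist x (frontier \<Omega>)"

text \<open>For a bounded domain and \<open>r > 0\<close> the set is nonempty and bounded above, so that the real
  supremum is the true one.\<close>

definition M_fun :: "(complex ^ 'n) set \<Rightarrow> real \<Rightarrow> real" where
  "M_fun \<Omega> r = Sup {1 / kobayashi_metric \<Omega> x v | x v.
                      x \<in> \<Omega> \<and> boundary_dist \<Omega> x \<le> r \<and> norm v = 1}"

definition goldilocks_domain :: "(complex ^ 'n) set \<Rightarrow> bool" where
  "goldilocks_domain \<Omega> \<longleftrightarrow>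
     bounded_domain \<Omega> \<and>
     (\<exists>\<epsilon>>0. (\<integral>\<^sup>+ r \<in> {0<..<\<epsilon>}. ennreal (1 / r * M_fun \<Omega> r) \<partial>lborel) < \<infinity>) \<and>
     (\<forall>x0\<in>\<Omega>. \<exists>C>0. \<exists>\<alpha>>0. \<forall>x\<in>\<Omega>.
        kobayashi_dist \<Omega> x0 x \<le> C + \<alpha> * ln (1 / boundary_dist \<Omega> x))"


section \<open>Metric geometry\<close>

definition quasi_isometric_embedding ::
  "'a set \<Rightarrow> ('a \<Rightarrow> 'a \<Rightarrow> real) \<Rightarrow> 'b set \<Rightarrow> ('b \<Rightarrow> 'b \<Rightarrow> real) \<Rightarrow> ('a \<Rightarrow> 'b) \<Rightarrow> bool" where
  "quasi_isometric_embedding X dX Y dY F \<longleftrightarrow>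
     F ` X \<subseteq> Y \<and>
     (\<exists>l\<ge>1. \<exists>\<kappa>\<ge>0. \<forall>x1\<in>X. \<forall>x2\<in>X.
        1 / l * dY (F x1) (F x2) - \<kappa> \<le> dX x1 x2 \<and>
        dX x1 x2 \<le> l * dY (F x1) (F x2) + \<kappa>)"

definition proper_space :: "'a set \<Rightarrow> ('a \<Rightarrow> 'a \<Rightarrow> real) \<Rightarrow> bool" where
  "proper_space X d \<longleftrightarrow>
     (\<forall>S\<subseteq>X. Metric_space.mbounded X d S \<longrightarrow>
        compactin (Metric_space.mtopology X d) (Metric_space.mtopology X d closure_of S))"

definition geodesic_space :: "'a set \<Rightarrow> ('a \<Rightarrow> 'a \<Rightarrow> real) \<Rightarrow> bool" where
  "geodesic_space X d \<longleftrightarrow>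
     (\<forall>x\<in>X. \<forall>y\<in>X. \<exists>\<sigma>::real \<Rightarrow> 'a.
        \<sigma> ` {0..d x y} \<subseteq> X \<and> \<sigma> 0 = x \<and> \<sigma> (d x y) = y \<and>
        (\<forall>s\<in>{0..d x y}. \<forall>t\<in>{0..d x y}. d (\<sigma> s) (\<sigma> t) = \<bar>s - t\<bar>))"

text \<open>\<open>gromov_product d p x y\<close> is \<open>(x|y)\<^sub>p\<close>.\<close>

definition gromov_product :: "('a \<Rightarrow> 'a \<Rightarrow> real) \<Rightarrow> 'a \<Rightarrow> 'a \<Rightarrow> 'a \<Rightarrow> real" where
  "gromov_product d p x y = (d x p + d p y - d x y) / 2"

definition gromov_hyperbolic :: "'a set \<Rightarrow> ('a \<Rightarrow> 'a \<Rightarrow> real) \<Rightarrow> bool" where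
  "gromov_hyperbolic X d \<longleftrightarrow>
     (\<exists>\<delta>\<ge>0. \<forall>p\<in>X. \<forall>x\<in>X. \<forall>y\<in>X. \<forall>z\<in>X.
        gromov_product d p x z \<ge> min (gromov_product d p x y) (gromov_product d p y z) - \<delta>)"


section \<open>The Gromov boundary and the Gromov compactification\<close>

text \<open>\<open>liminf\<close> of \<open>(x\<^sub>n|y\<^sub>m)\<^sub>p\<close> as \<open>n, m \<rightarrow> \<infinity>\<close> independently.\<close>

definition gromov_liminf ::
  "('a \<Rightarrow> 'a \<Rightarrow> real) \<Rightarrow> 'a \<Rightarrow> (nat \<Rightarrow> 'a) \<Rightarrow> (nat \<Rightarrow> 'a) \<Rightarrow> ereal" where
  "gromov_liminf d p x y =
     Liminf (sequentially \<times>\<^sub>F sequentially) (\<lambda>(n, m). ereal (gromov_product d p (x n) (y m)))"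

definition converges_at_infinity ::
  "'a set \<Rightarrow> ('a \<Rightarrow> 'a \<Rightarrow> real) \<Rightarrow> (nat \<Rightarrow> 'a) \<Rightarrow> bool" where
  "converges_at_infinity X d x \<longleftrightarrow> range x \<subseteq> X \<and> (\<exists>p\<in>X. gromov_liminf d p x x = \<infinity>)"

definition gromov_equiv :: "'a set \<Rightarrow> ('a \<Rightarrow> 'a \<Rightarrow> real) \<Rightarrow> ((nat \<Rightarrow> 'a) \<times> (nat \<Rightarrow> 'a)) set" where
  "gromov_equiv X d =
     {(x, y). converges_at_infinity X d x \<and> converges_at_infinity X d y \<and>
              (\<exists>p\<in>X. gromov_liminf d p x y = \<infinity>)}"

definition gromov_boundary :: "'a set \<Rightarrow> ('a \<Rightarrow> 'a \<Rightarrow> real) \<Rightarrow> (nat \<Rightarrow> 'a) set set" where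
  "gromov_boundary X d = {x. converges_at_infinity X d x} // gromov_equiv X d"

text \<open>The disjoint union of \<open>X\<close> and its Gromov boundary is \<open>X <+> gromov_boundary X d\<close>. The standard
  topology on it has the open sets of \<open>X\<close> together with, at a boundary point \<open>\<xi>\<close>, the neighbourhood
  basis of the sets \<open>gromov_nbhd X d p \<xi> R\<close> with \<open>R\<close> real, consisting of all points whose Gromov
  product with \<open>\<xi>\<close> is at least \<open>R\<close>. These sets need not be open themselves. The choice of \<open>p\<close> does
  not matter.\<close>

definition gromov_nbhd ::
  "'a set \<Rightarrow> ('a \<Rightarrow> 'a \<Rightarrow> real) \<Rightarrow> 'a \<Rightarrow> (nat \<Rightarrow> 'a) set \<Rightarrow> real \<Rightarrow> ('a + (nat \<Rightarrow> 'a) set) set" where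
  "gromov_nbhd X d p \<xi> R =
     {y \<in> X. \<exists>x\<in>\<xi>. liminf (\<lambda>n. ereal (gromov_product d p (x n) y)) \<ge> ereal R} <+>
     {\<eta> \<in> gromov_boundary X d. \<exists>x\<in>\<xi>. \<exists>y\<in>\<eta>. gromov_liminf d p x y \<ge> ereal R}"

definition gromov_compactification ::
  "'a set \<Rightarrow> ('a \<Rightarrow> 'a \<Rightarrow> real) \<Rightarrow> ('a + (nat \<Rightarrow> 'a) set) topology" where
  "gromov_compactification X d = topology (\<lambda>U.
     U \<subseteq> X <+> gromov_boundary X d \<and>
     openin (Metric_space.mtopology X d) (Inl -` U) \<and>
     (\<forall>\<xi>. Inr \<xi> \<in> U \<longrightarrow> (\<forall>p\<in>X. \<exists>R. gromov_nbhd X d p \<xi> R \<subseteq> U)))"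

lemma gromov_nbhd_antimono:
  assumes "R \<le> R'"
  shows "gromov_nbhd X d p \<xi> R' \<subseteq> gromov_nbhd X d p \<xi> R"
proof -
  have "ereal R \<le> ereal R'" using assms by simp
  then show ?thesis
    unfolding gromov_nbhd_def by (blast intro: order_trans)
qed

lemma openin_gromov_compactification:
  "openin (gromov_compactification X d) U \<longleftrightarrow>
     U \<subseteq> X <+> gromov_boundary X d \<and>
     openin (Metric_space.mtopology X d) (Inl -` U) \<and>
     (\<forall>\<xi>. Inr \<xi> \<in> U \<longrightarrow> (\<forall>p\<in>X. \<exists>R. gromov_nbhd X d p \<xi> R \<subseteq> U))"
proof -
  let ?P = "\<lambda>U. U \<subseteq> X <+> gromov_boundary X d \<and>
     openin (Metric_space.mtopology X d) (Inl -` U) \<and>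
     (\<forall>\<xi>. Inr \<xi> \<in> U \<longrightarrow> (\<forall>p\<in>X. \<exists>R. gromov_nbhd X d p \<xi> R \<subseteq> U))"
  have "istopology ?P"
    unfolding istopology_def
  proof (intro conjI allI impI ballI)
    fix S T assume S: "?P S" and T: "?P T"
    have "\<exists>R. gromov_nbhd X d p \<xi> R \<subseteq> S \<inter> T" if \<xi>: "Inr \<xi> \<in> S \<inter> T" and p: "p \<in> X" for \<xi> p
    proof -
      obtain R1 R2 where "gromov_nbhd X d p \<xi> R1 \<subseteq> S" "gromov_nbhd X d p \<xi> R2 \<subseteq> T"
        using S T \<xi> p by blast
      then have "gromov_nbhd X d p \<xi> (max R1 R2) \<subseteq> S \<inter> T"
        using gromov_nbhd_antimono[of R1 "max R1 R2" X d p \<xi>]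
              gromov_nbhd_antimono[of R2 "max R1 R2" X d p \<xi>] by auto
      then show ?thesis by blast
    qed
    then show "\<exists>R. gromov_nbhd X d p \<xi> R \<subseteq> S \<inter> T" if "Inr \<xi> \<in> S \<inter> T" "p \<in> X" for \<xi> p
      using that by blast
    show "S \<inter> T \<subseteq> X <+> gromov_boundary X d" using S by blast
    show "openin (Metric_space.mtopology X d) (Inl -` (S \<inter> T))"
      using S T by (simp add: vimage_Int openin_Int)
  next
    fix \<K> assume \<K>: "\<forall>K\<in>\<K>. ?P K"
    show "\<Union>\<K> \<subseteq> X <+> gromov_boundary X d" using \<K> by blast
    show "openin (Metric_space.mtopology X d) (Inl -` \<Union>\<K>)"
      using \<K> by (auto simp: vimage_Union)
    show "\<exists>R. gromov_nbhd X d p \<xi> R \<subseteq> \<Union>\<K>" if "Inr \<xi> \<in> \<Union>\<K>" "p \<in> X" for \<xi> p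
      using \<K> that by (meson Union_iff Union_upper order_trans)
  qed
  then show ?thesis
    unfolding gromov_compactification_def by (simp add: topology_inverse')
qed

lemma topspace_gromov_compactification:
  assumes "Metric_space X d"
  shows "topspace (gromov_compactification X d) = X <+> gromov_boundary X d"
proof -
  interpret Metric_space X d by fact
  have "Inl -` (X <+> gromov_boundary X d) = topspace mtopology" by auto
  moreover have "gromov_nbhd X d p \<xi> R \<subseteq> X <+> gromov_boundary X d" for p \<xi> R
    unfolding gromov_nbhd_def by auto
  ultimately have "openin (gromov_compactification X d) (X <+> gromov_boundary X d)"
    unfolding openin_gromov_compactification by (metis openin_topspace order_refl)
  then show ?thesis
    by (meson openin_gromov_compactification openin_subset openin_topspace subset_antisym)
qed

end

theory Submission
  imports Defs "HOL-Complex_Analysis.Complex_Analysis"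
begin

text \<open>The heart is a visibility property of Goldilocks domains. Let \<open>x\<close>, \<open>y\<close> in \<open>D\<close> have Gromov product
  at least \<open>R\<close> with respect to \<open>p\<close>. Every point of a geodesic from \<open>x\<close> to \<open>y\<close> then has distance at
  least \<open>R\<close> from \<open>p\<close>. Sample the geodesic at integer times and let \<open>w\<^sub>j\<close> be the images under \<open>F\<close>. If
  \<open>w\<^sub>i\<close> is the one nearest to \<open>F p\<close>, then \<open>K\<^sub>\<Omega>(F p, w\<^sub>j)\<close> is at least \<open>b (R + \<bar>i - j\<bar>) - c\<close>, so by the second
  Goldilocks condition the boundary distance near \<open>w\<^sub>j\<close> is at most \<open>A q^(R + \<bar>i - j\<bar>)\<close> with \<open>q < 1\<close>.
  A chain of discs from \<open>w\<^sub>j\<close> to \<open>w\<^sub>j\<^sub>+\<^sub>1\<close> of bounded length stays near \<open>w\<^sub>j\<close>, hence its Euclidean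
  displacement is \<open>O(M\<^sub>\<Omega>(A q^(R + \<bar>i - j\<bar>)))\<close>. The first Goldilocks condition says exactly that
  \<open>\<Sum>\<^sub>k M\<^sub>\<Omega>(A q^k)\<close> converges, so \<open>\<parallel>F x - F y\<parallel>\<close> is bounded by a tail of a convergent series and
  is small when \<open>R\<close> is large. This uniform continuity at infinity yields the extension.\<close>

no_notation fps_nth (infixl "$" 75)

section \<open>Extension to the Gromov boundary\<close>

lemma gromov_liminf_gt:
  assumes "ereal R < gromov_liminf d p x y"
  obtains N where "\<And>n m. n \<ge> N \<Longrightarrow> m \<ge> N \<Longrightarrow> R < gromov_product d p (x n) (y m)"
proof -
  have "eventually (\<lambda>z. ereal R < (case z of (n, m) \<Rightarrow> ereal (gromov_product d p (x n) (y m))))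
          (sequentially \<times>\<^sub>F sequentially)"
    using assms unfolding gromov_liminf_def by (rule less_LiminfD)
  then obtain N where "\<forall>m\<ge>N. \<forall>n\<ge>N. R < gromov_product d p (x n) (y m)"
    unfolding eventually_prod_sequentially by auto
  then show ?thesis using that by blast
qed

text \<open>Hypothesis \<open>vis\<close> is uniform continuity of \<open>F\<close> at infinity:
  sequences converging at infinity go to Cauchy sequences, equivalent ones to the same limit, and
  the estimate survives the passage to the limit, which gives continuity at boundary points.\<close>

lemma gromov_extension:
  fixes F :: "'a \<Rightarrow> 'b::complete_space"
  assumes X: "Metric_space X d"
    and cont: "continuous_map (Metric_space.mtopology X d) euclidean F"
    and im: "F ` X \<subseteq> \<Omega>"
    and vis: "\<And>p \<epsilon>. p \<in> X \<Longrightarrow> \<epsilon> > 0 \<Longrightarrow>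
      \<exists>R. \<forall>x\<in>X. \<forall>y\<in>X. gromov_product d p x y \<ge> R \<longrightarrow> dist (F x) (F y) \<le> \<epsilon>"
  shows "\<exists>F'. continuous_map (gromov_compactification X d) (top_of_set (closure \<Omega>)) F' \<and>
              (\<forall>x\<in>X. F' (Inl x) = F x)"
proof -
  have lim: "\<exists>L. L \<in> closure \<Omega> \<and> (\<forall>x\<in>\<xi>. range x \<subseteq> X \<and> (F \<circ> x) \<longlonglongrightarrow> L)"
    if \<xi>: "\<xi> \<in> gromov_boundary X d" for \<xi>
  proof -
    obtain x0 where x0: "converges_at_infinity X d x0" "\<xi> = gromov_equiv X d `` {x0}"
      using \<xi> unfolding gromov_boundary_def quotient_def by blast
    \<comment> \<open>The definitions only provide some base point, which varies with the sequences,
      like \<open>q\<close> below; \<open>vis\<close> holds at every base point, so none has to be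
      changed.\<close>
    obtain p where p: "p \<in> X" "gromov_liminf d p x0 x0 = \<infinity>" and x0X: "range x0 \<subseteq> X"
      using x0(1) unfolding converges_at_infinity_def by blast
    have "Cauchy (F \<circ> x0)"
    proof (rule metric_CauchyI)
      fix e :: real assume "0 < e"
      then obtain R where R: "\<And>x y. x \<in> X \<Longrightarrow> y \<in> X \<Longrightarrow> gromov_product d p x y \<ge> R \<Longrightarrow> dist (F x) (F y) \<le> e/2"
        using vis[OF p(1), of "e/2"] by auto
      obtain N where "\<And>n m. n \<ge> N \<Longrightarrow> m \<ge> N \<Longrightarrow> R < gromov_product d p (x0 n) (x0 m)"
        using gromov_liminf_gt[of R d p x0 x0] p(2) by auto
      then have "dist (F (x0 m)) (F (x0 n)) \<le> e/2" if "m \<ge> N" "n \<ge> N" for m n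
        using R x0X that by (meson less_imp_le range_subsetD)
      then show "\<exists>M. \<forall>m\<ge>M. \<forall>n\<ge>M. dist ((F \<circ> x0) m) ((F \<circ> x0) n) < e"
        using \<open>0 < e\<close> by (intro exI[of _ N]) fastforce
    qed
    then obtain L where L: "(F \<circ> x0) \<longlonglongrightarrow> L"
      using Cauchy_convergent_iff convergent_def by blast
    have "L \<in> closure \<Omega>"
      unfolding closure_sequential using L x0X im by (intro exI[of _ "F \<circ> x0"]) auto
    moreover have "range x \<subseteq> X \<and> (F \<circ> x) \<longlonglongrightarrow> L" if "x \<in> \<xi>" for x
    proof -
      obtain q where q: "q \<in> X" "gromov_liminf d q x0 x = \<infinity>" and xX: "range x \<subseteq> X"
        using \<open>x \<in> \<xi>\<close> unfolding x0(2) gromov_equiv_def converges_at_infinity_def by blast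
      have "(F \<circ> x) \<longlonglongrightarrow> L"
      proof (rule metric_LIMSEQ_I)
        fix e :: real assume "0 < e"
        then obtain R where R: "\<And>x y. x \<in> X \<Longrightarrow> y \<in> X \<Longrightarrow> gromov_product d q x y \<ge> R \<Longrightarrow> dist (F x) (F y) \<le> e/2"
          using vis[OF q(1), of "e/2"] by auto
        obtain N where N: "\<And>n m. n \<ge> N \<Longrightarrow> m \<ge> N \<Longrightarrow> R < gromov_product d q (x0 n) (x m)"
          using gromov_liminf_gt[of R d q x0 x] q(2) by auto
        obtain M where M: "\<And>n. n \<ge> M \<Longrightarrow> dist (F (x0 n)) L < e/2"
          using metric_LIMSEQ_D[OF L, of "e/2"] \<open>0 < e\<close> by auto
        have "dist (F (x m)) L < e" if "m \<ge> N" for m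
        proof -
          let ?n = "max M N"
          have "dist (F (x0 ?n)) (F (x m)) \<le> e/2"
            using R N[of ?n m] that x0X xX by (meson less_imp_le max.cobounded2 range_subsetD)
          moreover have "dist (F (x0 ?n)) L < e/2" using M by simp
          ultimately show ?thesis
            using dist_triangle3[of "F (x m)" L "F (x0 ?n)"] by simp
        qed
        then show "\<exists>no. \<forall>n\<ge>no. dist ((F \<circ> x) n) L < e" by auto
      qed
      then show ?thesis using xX by simp
    qed
    ultimately show ?thesis by blast
  qed
  then obtain G where G: "\<And>\<xi>. \<xi> \<in> gromov_boundary X d \<Longrightarrow> G \<xi> \<in> closure \<Omega>"
    and GX: "\<And>\<xi> x. \<xi> \<in> gromov_boundary X d \<Longrightarrow> x \<in> \<xi> \<Longrightarrow> range x \<subseteq> X"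
    and GL: "\<And>\<xi> x. \<xi> \<in> gromov_boundary X d \<Longrightarrow> x \<in> \<xi> \<Longrightarrow> (F \<circ> x) \<longlonglongrightarrow> G \<xi>"
    by metis
  let ?F = "case_sum F G" and ?T = "gromov_compactification X d"
  have top: "topspace ?T = X <+> gromov_boundary X d"
    by (rule topspace_gromov_compactification[OF X])
  have "continuous_map ?T euclidean ?F"
    unfolding continuous_map_def
  proof (intro conjI allI impI)
    fix U :: "'b set" assume "openin euclidean U"
    then have "open U" by simp
    let ?V = "{z \<in> topspace ?T. ?F z \<in> U}"
    have "Inl -` ?V = {x \<in> topspace (Metric_space.mtopology X d). F x \<in> U}"
      by (auto simp: top Metric_space.topspace_mtopology[OF X])
    then have "openin (Metric_space.mtopology X d) (Inl -` ?V)"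
      using cont \<open>open U\<close> by (simp add: continuous_map_def)
    moreover have "\<exists>R. gromov_nbhd X d p \<xi> R \<subseteq> ?V" if \<xi>V: "Inr \<xi> \<in> ?V" and p: "p \<in> X" for \<xi> p
    proof -
      have \<xi>: "\<xi> \<in> gromov_boundary X d" and "G \<xi> \<in> U" using \<xi>V by (auto simp: top)
      then obtain e where e: "e > 0" "\<And>u. dist u (G \<xi>) < e \<Longrightarrow> u \<in> U"
        using \<open>open U\<close> unfolding open_dist by blast
      obtain R where R: "\<And>x y. x \<in> X \<Longrightarrow> y \<in> X \<Longrightarrow> gromov_product d p x y \<ge> R \<Longrightarrow> dist (F x) (F y) \<le> e/2"
        using vis[OF p, of "e/2"] e by auto
      have "F y \<in> U" if y: "y \<in> X" "x \<in> \<xi>" "liminf (\<lambda>n. ereal (gromov_product d p (x n) y)) \<ge> ereal (R+1)" for x y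
      proof -
        \<comment> \<open>The threshold \<open>R+1\<close> leaves room for a strict inequality,
          which passes from the liminf to all late terms.\<close>
        have "ereal R < liminf (\<lambda>n. ereal (gromov_product d p (x n) y))"
          using y(3) by (rule less_le_trans[rotated]) simp
        then have "\<forall>\<^sub>F n in sequentially. R < gromov_product d p (x n) y"
          using less_LiminfD by fastforce
        then have h1: "\<forall>\<^sub>F n in sequentially. dist ((F \<circ> x) n) (F y) \<le> e/2"
          by (rule eventually_mono) (use R y GX[OF \<xi> y(2)] in \<open>simp add: image_subset_iff less_imp_le\<close>)
        have h2: "(\<lambda>n. dist ((F \<circ> x) n) (F y)) \<longlonglongrightarrow> dist (G \<xi>) (F y)"
          by (intro tendsto_intros GL[OF \<xi> y(2)])
        have "dist (G \<xi>) (F y) \<le> e/2" 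
          by (intro tendsto_upperbound[OF h2 h1]) simp
        then show ?thesis using e by (intro e(2)) (simp add: dist_commute)
      qed
      moreover have "G \<eta> \<in> U" if \<eta>: "\<eta> \<in> gromov_boundary X d" "x \<in> \<xi>" "y \<in> \<eta>"
        "gromov_liminf d p x y \<ge> ereal (R+1)" for \<eta> x y
      proof -
        have "ereal R < gromov_liminf d p x y"
          using \<eta>(4) by (rule less_le_trans[rotated]) simp
        then obtain N where N: "\<And>n m. n \<ge> N \<Longrightarrow> m \<ge> N \<Longrightarrow> R < gromov_product d p (x n) (y m)"
          using gromov_liminf_gt[of R d p x y] by auto
        have h1: "\<forall>\<^sub>F n in sequentially. dist ((F \<circ> x) n) ((F \<circ> y) n) \<le> e/2"
          using N R GX[OF \<xi> \<eta>(2)] GX[OF \<eta>(1,3)]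
          by (intro eventually_sequentiallyI[of N]) (simp add: image_subset_iff less_imp_le)
        have h2: "(\<lambda>n. dist ((F \<circ> x) n) ((F \<circ> y) n)) \<longlonglongrightarrow> dist (G \<xi>) (G \<eta>)"
          by (intro tendsto_intros GL[OF \<xi> \<eta>(2)] GL[OF \<eta>(1,3)])
        have "dist (G \<xi>) (G \<eta>) \<le> e/2" 
          by (intro tendsto_upperbound[OF h2 h1]) simp
        then show ?thesis using e by (intro e(2)) (simp add: dist_commute)
      qed
      ultimately have "gromov_nbhd X d p \<xi> (R+1) \<subseteq> ?V"
        unfolding gromov_nbhd_def top by fastforce
      then show ?thesis by blast
    qed
    moreover have "?V \<subseteq> X <+> gromov_boundary X d" unfolding top by blast
    ultimately show "openin ?T ?V"
      unfolding openin_gromov_compactification by blast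
  qed simp
  moreover have "?F ` topspace ?T \<subseteq> closure \<Omega>"
    using im G closure_subset[of \<Omega>] unfolding top by (auto simp: image_subset_iff subset_iff)
  ultimately have "continuous_map ?T (top_of_set (closure \<Omega>)) ?F"
    by (simp add: continuous_map_in_subtopology image_subset_iff_funcset)
  then show ?thesis by (intro exI[of _ ?F]) simp
qed

section \<open>Holomorphic discs and the Kobayashi metric\<close>

lemma norm_vector_smult:
  fixes v :: "'a::real_normed_field ^ 'n"
  shows "norm (c *s v) = norm c * norm v"
  by (simp add: norm_vec_def norm_mult L2_set_right_distrib)

text \<open>At \<open>0\<close> this is the vector written out in \<open>kobayashi_metric\<close>;
  the other points serve to differentiate along a radius.\<close>

definition vec_deriv :: "(complex \<Rightarrow> complex ^ 'n) \<Rightarrow> complex \<Rightarrow> complex ^ 'n" where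
  "vec_deriv \<phi> z = (\<chi> i. deriv (\<lambda>z. \<phi> z $ i) z)"

lemma holomorphic_discsD:
  assumes "\<phi> \<in> holomorphic_discs \<Omega>" 
  shows "(\<lambda>z. \<phi> z $ i) holomorphic_on ball 0 1" "norm z < 1 \<Longrightarrow> \<phi> z \<in> \<Omega>"
  using assms unfolding holomorphic_discs_def by auto

lemma holomorphic_discs_compose:
  assumes "\<phi> \<in> holomorphic_discs \<Omega>" "g holomorphic_on ball 0 1" "g ` ball 0 1 \<subseteq> ball 0 1"
  shows "(\<lambda>z. \<phi> (g z)) \<in> holomorphic_discs \<Omega>"
  using assms holomorphic_on_compose_gen[OF assms(2) holomorphic_discsD(1)[OF assms(1)] assms(3)]
  unfolding holomorphic_discs_def o_def by blast

lemma vec_deriv_compose: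
  assumes "\<phi> \<in> holomorphic_discs \<Omega>" "g holomorphic_on ball 0 1" "norm z < 1" "norm (g z) < 1"
  shows "vec_deriv (\<lambda>z. \<phi> (g z)) z = deriv g z *s vec_deriv \<phi> (g z)"
proof -
  have "deriv (\<lambda>z. \<phi> (g z) $ i) z = deriv g z * deriv (\<lambda>z. \<phi> z $ i) (g z)" for i
  proof -
    have "g field_differentiable at z"
      using assms by (intro holomorphic_on_imp_differentiable_at[of g "ball 0 1"]) auto
    moreover have "(\<lambda>z. \<phi> z $ i) field_differentiable at (g z)"
      using assms holomorphic_discsD by (intro holomorphic_on_imp_differentiable_at[of _ "ball 0 1"]) auto
    ultimately show ?thesis
      using deriv_chain[of g z "\<lambda>z. \<phi> z $ i"] by (simp add: o_def mult.commute)
  qed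
  then show ?thesis by (simp add: vec_deriv_def vec_eq_iff)
qed

section \<open>Competing discs and bounds for the infinitesimal metric\<close>

lemma kobayashi_metric_le:
  assumes "\<phi> \<in> holomorphic_discs \<Omega>" "\<phi> 0 = x" "\<xi> *s vec_deriv \<phi> 0 = v"
  shows "kobayashi_metric \<Omega> x v \<le> norm \<xi>"
  unfolding kobayashi_metric_def
proof (rule cInf_lower)
  show "norm \<xi> \<in> {norm \<xi> |\<xi> \<phi>. \<phi> \<in> holomorphic_discs \<Omega> \<and> \<phi> 0 = x \<and> \<xi> *s (\<chi> i. deriv (\<lambda>z. \<phi> z $ i) 0) = v}"
    using assms unfolding vec_deriv_def by blast
  show "bdd_below {norm \<xi> |\<xi> \<phi>. \<phi> \<in> holomorphic_discs \<Omega> \<and> \<phi> 0 = x \<and> \<xi> *s (\<chi> i. deriv (\<lambda>z. \<phi> z $ i) 0) = v}"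
    by (rule bdd_belowI[of _ 0]) auto
qed

text \<open>Affine discs provide competitors for the metric at every point of an open set, and
  chains between nearby points.\<close>

lemma affine_disc:
  fixes x :: "complex ^ 'n"
  assumes "0 < r" "ball x r \<subseteq> \<Omega>" "norm w \<le> r" 
  shows "(\<lambda>z. x + z *s w) \<in> holomorphic_discs \<Omega>" "vec_deriv (\<lambda>z. x + z *s w) 0 = w"
proof -
  have "x + z *s w \<in> ball x r" if "norm z < 1" for z
  proof (cases "w = 0")
    case True
    then show ?thesis using assms(1) by simp
  next
    case False
    then have "norm z * norm w < 1 * norm w" using that by (intro mult_strict_right_mono) auto
    then show ?thesis using assms by (simp add: dist_norm norm_vector_smult)
  qed
  then show "(\<lambda>z. x + z *s w) \<in> holomorphic_discs \<Omega>"
    using assms(2) unfolding holomorphic_discs_def by (auto intro!: holomorphic_intros)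
  have "((\<lambda>z. x $ i + z * w $ i) has_field_derivative w $ i) (at 0)" for i
    by (auto intro!: derivative_eq_intros)
  then have "deriv (\<lambda>z. x $ i + z * w $ i) 0 = w $ i" for i
    by (rule DERIV_imp_deriv)
  then show "vec_deriv (\<lambda>z. x + z *s w) 0 = w"
    by (simp add: vec_deriv_def vec_eq_iff)
qed

text \<open>Cauchy's estimate for each component; boundedness of \<open>\<Omega>\<close> makes it
  uniform in the disc.\<close>

lemma vec_deriv_bound:
  fixes \<Omega> :: "(complex ^ 'n) set"
  assumes "bounded \<Omega>"
  obtains C where "C > 0" "\<And>\<phi>. \<phi> \<in> holomorphic_discs \<Omega> \<Longrightarrow> norm (vec_deriv \<phi> 0) \<le> C"
proof -
  obtain B where B: "B > 0" "\<And>x. x \<in> \<Omega> \<Longrightarrow> norm x \<le> B"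
    using assms bounded_pos by metis
  have "norm (vec_deriv \<phi> 0) \<le> real CARD('n) * (2 * B)" if \<phi>: "\<phi> \<in> holomorphic_discs \<Omega>" for \<phi> :: "complex \<Rightarrow> complex ^ 'n"
  proof -
    have "norm (deriv (\<lambda>z. \<phi> z $ i) 0) \<le> 2 * B" for i
    proof -
      have hol: "(\<lambda>z. \<phi> z $ i) holomorphic_on ball 0 1" by (rule holomorphic_discsD[OF \<phi>])
      \<comment> \<open>The circle of radius 1/2 keeps the closed disc inside the domain of
        holomorphy, at the cost of a factor 2.\<close>
      have "norm ((deriv ^^ 1) (\<lambda>z. \<phi> z $ i) 0) \<le> fact 1 * B / (1/2) ^ 1"
      proof (rule Cauchy_inequality)
        show "(\<lambda>z. \<phi> z $ i) holomorphic_on ball 0 (1/2)"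
          by (rule holomorphic_on_subset[OF hol]) auto
        show "continuous_on (cball 0 (1/2)) (\<lambda>z. \<phi> z $ i)"
          by (rule continuous_on_subset[OF holomorphic_on_imp_continuous_on[OF hol]]) auto
        show "norm (\<phi> z $ i) \<le> B" if "norm (0 - z) = 1/2" for z
          using Finite_Cartesian_Product.norm_nth_le[of "\<phi> z" i] B(2)[OF holomorphic_discsD(2)[OF \<phi>, of z]] that by simp
      qed simp
      then show ?thesis by simp
    qed
    then have "(\<Sum>i\<in>UNIV. norm (deriv (\<lambda>z. \<phi> z $ i) 0)) \<le> (\<Sum>i\<in>(UNIV::'n set). 2 * B)"
      by (intro sum_mono) auto
    moreover have "norm (vec_deriv \<phi> 0) \<le> (\<Sum>i\<in>UNIV. norm (deriv (\<lambda>z. \<phi> z $ i) 0))"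
      unfolding vec_deriv_def norm_vec_def vec_lambda_beta by (rule L2_set_le_sum) simp
    ultimately show ?thesis by simp
  qed
  then show ?thesis using B(1) that[of "real CARD('n) * (2 * B)"] by simp
qed

text \<open>A competitor for a unit vector satisfies \<open>1 = |\<xi>| |\<phi>'(0)|\<close>, so a
  bound \<open>C\<close> on the derivatives keeps \<open>|\<xi>|\<close> away from zero.\<close>

lemma kobayashi_metric_lower_bound:
  fixes \<Omega> :: "(complex ^ 'n) set"
  assumes "open \<Omega>" "bounded \<Omega>"
  obtains C where "C > 0" "\<And>x v. x \<in> \<Omega> \<Longrightarrow> norm v = 1 \<Longrightarrow> 1 / C \<le> kobayashi_metric \<Omega> x v"
proof -
  obtain C where C: "C > 0" "\<And>\<phi>. \<phi> \<in> holomorphic_discs \<Omega> \<Longrightarrow> norm (vec_deriv \<phi> 0) \<le> C"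
    using vec_deriv_bound[OF assms(2)] by blast
  have "1 / C \<le> kobayashi_metric \<Omega> x v" if x: "x \<in> \<Omega>" and v: "norm v = 1" for x v
    unfolding kobayashi_metric_def vec_deriv_def[symmetric]
  proof (rule cInf_greatest)
    \<comment> \<open>A lower bound for a real infimum requires a competitor: the affine disc with
      derivative \<open>r v\<close> and \<open>\<xi> = 1/r\<close>.\<close>
    obtain r where r: "r > 0" "ball x r \<subseteq> \<Omega>" using x assms(1) open_contains_ball by blast
    have w: "norm (complex_of_real r *s v) \<le> r" using r v by (simp add: norm_vector_smult)
    have "complex_of_real (1/r) *s vec_deriv (\<lambda>z. x + z *s (complex_of_real r *s v)) 0 = v"
      unfolding affine_disc(2)[OF r w] unfolding vector_smult_assoc using r by simp
    then show "{norm \<xi> |\<xi> \<phi>. \<phi> \<in> holomorphic_discs \<Omega> \<and> \<phi> 0 = x \<and> \<xi> *s vec_deriv \<phi> 0 = v} \<noteq> {}"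
      using affine_disc(1)[OF r w] by force
    fix y assume "y \<in> {norm \<xi> |\<xi> \<phi>. \<phi> \<in> holomorphic_discs \<Omega> \<and> \<phi> 0 = x \<and> \<xi> *s vec_deriv \<phi> 0 = v}"
    then obtain \<xi> \<phi> where y: "y = norm \<xi>" "\<phi> \<in> holomorphic_discs \<Omega>" "\<xi> *s vec_deriv \<phi> 0 = v" by blast
    have "1 = norm \<xi> * norm (vec_deriv \<phi> 0)" using v y(3) by (metis norm_vector_smult)
    also have "\<dots> \<le> norm \<xi> * C" using C(2)[OF y(2)] by (intro mult_left_mono) auto
    finally show "1 / C \<le> y" using C(1) y(1) by (simp add: field_simps)
  qed
  then show ?thesis using C(1) that by blast
qed

lemma kobayashi_metric_pos:
  assumes "open \<Omega>" "bounded \<Omega>" "x \<in> \<Omega>" "norm v = 1"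
  shows "0 < kobayashi_metric \<Omega> x v"
  using kobayashi_metric_lower_bound[OF assms(1,2)] assms(3,4)
  by (metis zero_less_divide_1_iff less_le_trans)

section \<open>Euclidean displacement along one disc\<close>

text \<open>Recentring: precompose with the disc automorphism \<open>g\<close> that takes
  \<open>0\<close> to \<open>s\<close>. The new disc has derivative
  \<open>(1 - s^2) \<phi>'(s)\<close> at \<open>0\<close>, so it competes at
  \<open>\<phi>(s)\<close> for the direction of \<open>\<phi>'(s)\<close>.\<close>

lemma vec_deriv_le:
  fixes \<Omega> :: "(complex ^ 'n) set"
  assumes \<Omega>: "open \<Omega>" "bounded \<Omega>" and \<phi>: "\<phi> \<in> holomorphic_discs \<Omega>" and s: "0 \<le> s" "s < 1"
    and m: "0 \<le> m" "\<And>v. norm v = 1 \<Longrightarrow> 1 / kobayashi_metric \<Omega> (\<phi> (of_real s)) v \<le> m"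
  shows "norm (vec_deriv \<phi> (of_real s)) \<le> m * (1 / (1 - s\<^sup>2))"
proof (cases "vec_deriv \<phi> (of_real s) = 0")
  case True
  have "s\<^sup>2 < 1" using s by (simp add: power_less_one_iff abs_square_less_1)
  with True m(1) show ?thesis by simp
next
  case False
  define g where "g = Moebius_function 0 (- of_real s)"
  define v where "v = vec_deriv \<phi> (of_real s)"
  have s2: "0 < 1 - s\<^sup>2" using s by (simp add: power_less_one_iff abs_square_less_1)
  have ns: "norm (- complex_of_real s) < 1" using s by simp
  have hol: "g holomorphic_on ball 0 1"
    unfolding g_def by (rule Moebius_function_holomorphic[OF ns])
  have img: "g ` ball 0 1 \<subseteq> ball 0 1"
    unfolding g_def using Moebius_function_norm_lt_1[OF ns] by auto
  have g0: "g 0 = of_real s" by (simp add: g_def Moebius_function_of_zero)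
  have "((\<lambda>z::complex. (z + of_real s) / (1 + of_real s * z)) has_field_derivative of_real (1 - s\<^sup>2)) (at 0)"
    by (auto intro!: derivative_eq_intros simp: power2_eq_square)
  moreover have "g = (\<lambda>z. (z + of_real s) / (1 + of_real s * z))"
    by (simp add: g_def Moebius_function_simple fun_eq_iff)
  ultimately have dg: "deriv g 0 = of_real (1 - s\<^sup>2)" by (simp add: DERIV_imp_deriv)
  have "vec_deriv (\<lambda>z. \<phi> (g z)) 0 = deriv g 0 *s vec_deriv \<phi> (g 0)"
    using g0 s by (intro vec_deriv_compose[OF \<phi> hol]) auto
  then have vd: "vec_deriv (\<lambda>z. \<phi> (g z)) 0 = of_real (1 - s\<^sup>2) *s v"
    by (simp only: dg g0 v_def)
  \<comment> \<open>\<open>\<xi>\<close> is the factor that rescales the derivative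
    \<open>(1 - s^2) v\<close> of the recentred disc to the unit vector \<open>u\<close>.\<close>
  define \<xi> where "\<xi> = complex_of_real (1 / ((1 - s\<^sup>2) * norm v))"
  define u where "u = complex_of_real (1 / norm v) *s v"
  have v0: "norm v > 0" using False by (simp add: v_def)
  have "\<xi> * of_real (1 - s\<^sup>2) = of_real (1 / norm v)"
    unfolding \<xi>_def of_real_mult[symmetric] using s2 by simp
  then have "\<xi> *s vec_deriv (\<lambda>z. \<phi> (g z)) 0 = u"
    unfolding vd u_def by (simp only: vector_smult_assoc)
  then have k: "kobayashi_metric \<Omega> (\<phi> (of_real s)) u \<le> norm \<xi>"
    using kobayashi_metric_le[OF holomorphic_discs_compose[OF \<phi> hol img]] g0 by simp
  have u: "norm u = 1" unfolding u_def norm_vector_smult using v0 by (simp add: norm_divide)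
  have kpos: "0 < kobayashi_metric \<Omega> (\<phi> (of_real s)) u"
    using s by (intro kobayashi_metric_pos[OF \<Omega> _ u] holomorphic_discsD(2)[OF \<phi>]) simp
  have "(1 - s\<^sup>2) * norm v = 1 / norm \<xi>" using s2 v0 unfolding \<xi>_def norm_of_real by simp
  also have "\<dots> \<le> 1 / kobayashi_metric \<Omega> (\<phi> (of_real s)) u"
    using k kpos by (intro divide_left_mono) (auto intro: less_le_trans mult_pos_pos)
  also have "\<dots> \<le> m" by (rule m(2)[OF u])
  finally show ?thesis using s2 by (simp add: v_def field_simps)
qed

text \<open>The components are complex differentiable; their restrictions to the real diameter are
  assembled over the real basis vectors \<open>axis i b\<close>.\<close>

lemma disc_has_vector_derivative:
  fixes \<phi> :: "complex \<Rightarrow> complex ^ 'n"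
  assumes "\<phi> \<in> holomorphic_discs \<Omega>" "\<bar>s\<bar> < 1"
  shows "((\<lambda>s. \<phi> (of_real s)) has_vector_derivative vec_deriv \<phi> (of_real s)) (at s)"
  unfolding has_vector_derivative_def
proof (subst has_derivative_componentwise_within, intro ballI)
  fix j :: "complex ^ 'n" assume "j \<in> Basis"
  then obtain i b where j: "j = axis i b" by (auto simp: Basis_vec_def)
  have "((\<lambda>z. \<phi> z $ i) has_field_derivative deriv (\<lambda>z. \<phi> z $ i) (of_real s)) (at (of_real s))"
    using assms by (intro holomorphic_derivI[OF holomorphic_discsD(1)[OF assms(1)]]) auto
  then have "((\<lambda>s. \<phi> (of_real s) $ i) has_vector_derivative deriv (\<lambda>z. \<phi> z $ i) (of_real s)) (at s)"
    by (rule has_vector_derivative_real_field)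
  then have "((\<lambda>s. \<phi> (of_real s) $ i \<bullet> b) has_derivative (\<lambda>x. (x *\<^sub>R deriv (\<lambda>z. \<phi> z $ i) (of_real s)) \<bullet> b)) (at s)"
    unfolding has_vector_derivative_def by (rule has_derivative_inner_left)
  then show "((\<lambda>s. \<phi> (of_real s) \<bullet> j) has_derivative (\<lambda>x. (x *\<^sub>R vec_deriv \<phi> (of_real s)) \<bullet> j)) (at s)"
    by (simp add: j inner_axis vec_deriv_def)
qed

text \<open>The function \<open>m * artanh\<close> has derivative \<open>m / (1 - s^2)\<close>,
  which dominates the speed of the disc by \<open>vec_deriv_le\<close>; the mean value inequality
  integrates this. Only the metric along the radius up to \<open>t\<close> enters, which permits
  localisation.\<close>

lemma disc_displacement:
  fixes \<Omega> :: "(complex ^ 'n) set"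
  assumes \<Omega>: "open \<Omega>" "bounded \<Omega>" and \<phi>: "\<phi> \<in> holomorphic_discs \<Omega>" and t: "0 \<le> t" "t < 1"
    and m: "0 \<le> m" "\<And>s v. 0 \<le> s \<Longrightarrow> s \<le> t \<Longrightarrow> norm v = 1 \<Longrightarrow> 1 / kobayashi_metric \<Omega> (\<phi> (of_real s)) v \<le> m"
  shows "norm (\<phi> (of_real t) - \<phi> 0) \<le> m * artanh t"
proof (cases "t = 0")
  case False
  have "norm (\<phi> (of_real t) - \<phi> (of_real 0)) \<le> m * artanh t - m * artanh 0"
  proof (rule differentiable_bound_general)
    show "0 < t" using t False by simp
    show "continuous_on {0..t} (\<lambda>s. \<phi> (of_real s))"
      by (intro continuous_at_imp_continuous_on ballI 
            has_vector_derivative_continuous[OF disc_has_vector_derivative[OF \<phi>]]) (use t in auto)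
    show "continuous_on {0..t} (\<lambda>s. m * artanh s)"
      using t by (intro continuous_intros) auto
    show "((\<lambda>s. \<phi> (of_real s)) has_vector_derivative vec_deriv \<phi> (of_real s)) (at s)" if "0 < s" "s < t" for s
      using that t by (intro disc_has_vector_derivative[OF \<phi>]) auto
    show "((\<lambda>s. m * artanh s) has_vector_derivative m * (1 / (1 - s\<^sup>2))) (at s)" if "0 < s" "s < t" for s
      unfolding has_real_derivative_iff_has_vector_derivative[symmetric]
      using that t by (auto intro!: derivative_eq_intros)
    show "norm (vec_deriv \<phi> (of_real s)) \<le> m * (1 / (1 - s\<^sup>2))" if "0 < s" "s < t" for s
      using that t m by (intro vec_deriv_le[OF \<Omega> \<phi>]) auto
  qed
  then show ?thesis by simp
qed simp

text \<open>A Moebius map moves \<open>a\<close> to \<open>0\<close> and \<open>b\<close> to a point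
  \<open>w\<close> whose modulus is the argument of \<open>artanh\<close> in
  \<open>poincare_dist\<close>; a rotation brings \<open>w\<close> to
  \<open>t = |w|\<close>.\<close>

lemma normalised_disc:
  assumes \<phi>: "\<phi> \<in> holomorphic_discs \<Omega>" and ab: "norm a < 1" "norm b < 1"
  obtains \<psi> t where "\<psi> \<in> holomorphic_discs \<Omega>" "0 \<le> t" "t < 1" "\<psi> 0 = \<phi> a" "\<psi> (of_real t) = \<phi> b"
    "poincare_dist a b = artanh t"
proof -
  define w where "w = Moebius_function 0 a b"
  \<comment> \<open>The value 1 covers \<open>a = b\<close>, where \<open>w = 0\<close> has no
    direction.\<close>
  define u where "u = (if w = 0 then 1 else w / of_real (norm w))"
  have u: "norm u = 1" "of_real (norm w) * u = w" by (auto simp: u_def norm_divide)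
  have w: "norm w < 1" unfolding w_def by (rule Moebius_function_norm_lt_1[OF ab])
  define g where "g = (\<lambda>z. Moebius_function 0 (-a) (z * u))"
  have na: "norm (-a) < 1" using ab by simp
  have "(Moebius_function 0 (-a) \<circ> (\<lambda>z. z * u)) holomorphic_on ball 0 1"
    by (rule holomorphic_on_compose_gen[OF _ Moebius_function_holomorphic[OF na]])
      (use u in \<open>auto simp: norm_mult intro!: holomorphic_intros\<close>)
  then have hol: "g holomorphic_on ball 0 1" by (simp add: g_def o_def)
  have img: "g ` ball 0 1 \<subseteq> ball 0 1"
    unfolding g_def using Moebius_function_norm_lt_1[OF na] u by (auto simp: norm_mult)
  have "g (of_real (norm w)) = b"
    unfolding g_def u(2) unfolding w_def by (rule Moebius_function_compose) (use ab in auto)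
  moreover have "g 0 = a" by (simp add: g_def Moebius_function_of_zero)
  moreover have "poincare_dist a b = artanh (norm w)"
    by (simp add: poincare_dist_def w_def Moebius_function_simple norm_divide norm_minus_commute)
  ultimately show ?thesis
    using that[OF holomorphic_discs_compose[OF \<phi> hol img], of "norm w"] w by simp
qed

section \<open>Chains of discs and the Kobayashi distance\<close>

lemma poincare_dist_commute: "poincare_dist a b = poincare_dist b a"
proof -
  have "cnj (1 - cnj a * b) = 1 - cnj b * a" by (simp add: mult.commute)
  then have "norm (1 - cnj a * b) = norm (1 - cnj b * a)" by (metis complex_mod_cnj)
  then show ?thesis by (simp add: poincare_dist_def norm_divide norm_minus_commute)
qed

lemma artanh_mono: "0 \<le> s \<Longrightarrow> s \<le> t \<Longrightarrow> t < 1 \<Longrightarrow> artanh s \<le> artanh (t::real)"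
  unfolding artanh_def by (simp add: frac_le)

lemma artanh_nonneg: "0 \<le> t \<Longrightarrow> t < 1 \<Longrightarrow> 0 \<le> artanh (t::real)"
  using artanh_mono[of 0 t] by simp

lemma poincare_dist_0: "0 \<le> t \<Longrightarrow> poincare_dist 0 (of_real t) = artanh t"
  by (simp add: poincare_dist_def)

lemma poincare_dist_nonneg:
  assumes "norm a < 1" "norm b < 1"
  shows "0 \<le> poincare_dist a b"
proof -
  have "norm (Moebius_function 0 a b) < 1" using assms by (rule Moebius_function_norm_lt_1)
  then show ?thesis
    by (simp add: poincare_dist_def Moebius_function_simple norm_divide norm_minus_commute artanh_nonneg)
qed

text \<open>These are the chains in \<open>kobayashi_dist\<close>, with \<open>c\<close> their total
  length. Growing them disc by disc turns concatenation, reversal and displacement estimates into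
  inductions.\<close>

inductive kobayashi_chain :: "(complex ^ 'n) set \<Rightarrow> complex ^ 'n \<Rightarrow> complex ^ 'n \<Rightarrow> real \<Rightarrow> bool"
  for \<Omega> where
  refl: "kobayashi_chain \<Omega> x x 0"
| step: "kobayashi_chain \<Omega> x (\<phi> a) c \<Longrightarrow> \<phi> \<in> holomorphic_discs \<Omega> \<Longrightarrow> norm a < 1 \<Longrightarrow> norm b < 1 \<Longrightarrow>
    kobayashi_chain \<Omega> x (\<phi> b) (c + poincare_dist a b)"

lemma kobayashi_chain_disc:
  "\<phi> \<in> holomorphic_discs \<Omega> \<Longrightarrow> norm a < 1 \<Longrightarrow> norm b < 1 \<Longrightarrow>
    kobayashi_chain \<Omega> (\<phi> a) (\<phi> b) (poincare_dist a b)"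
  using kobayashi_chain.step[OF kobayashi_chain.refl] by fastforce

lemma kobayashi_chain_trans:
  assumes "kobayashi_chain \<Omega> y z c2" "kobayashi_chain \<Omega> x y c1"
  shows "kobayashi_chain \<Omega> x z (c1 + c2)"
  using assms
proof (induction rule: kobayashi_chain.induct)
  case (step y \<phi> a c b)
  then show ?case using kobayashi_chain.step[of \<Omega> x \<phi> a "c1 + c" b] by (simp add: add.assoc)
qed simp

lemma kobayashi_chain_sym:
  assumes "kobayashi_chain \<Omega> x y c"
  shows "kobayashi_chain \<Omega> y x c"
  using assms
proof (induction rule: kobayashi_chain.induct)
  case (step x \<phi> a c b)
  then show ?case
    using kobayashi_chain_trans[OF step.IH kobayashi_chain_disc[OF step(2,4,3)]]
    by (simp add: poincare_dist_commute add.commute)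
qed (rule kobayashi_chain.refl)

lemma kobayashi_chain_nonneg:
  assumes "kobayashi_chain \<Omega> x y c"
  shows "0 \<le> c"
  using assms by induction (auto simp: poincare_dist_nonneg)

text \<open>Induction on the number of discs turns the indexed families of the definition into a
  \<open>kobayashi_chain\<close>; induction on the chain goes back.\<close>

lemma kobayashi_dist_eq:
  assumes "x \<in> \<Omega>" "y \<in> \<Omega>"
  shows "kobayashi_dist \<Omega> x y = Inf {c. kobayashi_chain \<Omega> x y c}"
proof -
  define P where "P n p \<phi> a b y \<longleftrightarrow> p 0 = x \<and> p n = y \<and>
      (\<forall>j<n. \<phi> j \<in> holomorphic_discs \<Omega> \<and> a j \<in> ball 0 1 \<and> b j \<in> ball 0 1 \<and>
                      \<phi> j (a j) = p j \<and> \<phi> j (b j) = p (Suc j))" for n p \<phi> a b y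
  have 1: "kobayashi_chain \<Omega> x y (\<Sum>j<n. poincare_dist (a j) (b j))" if "P n p \<phi> a b y" for n p \<phi> a b y
    using that
  proof (induction n arbitrary: y)
    case 0
    then show ?case using kobayashi_chain.refl by (auto simp: P_def)
  next
    case (Suc n)
    have "P n p \<phi> a b (p n)" using Suc.prems by (auto simp: P_def)
    then have "kobayashi_chain \<Omega> x (p n) (\<Sum>j<n. poincare_dist (a j) (b j))" by (rule Suc.IH)
    moreover have "\<phi> n \<in> holomorphic_discs \<Omega>" "norm (a n) < 1" "norm (b n) < 1" "\<phi> n (a n) = p n" "\<phi> n (b n) = y"
      using Suc.prems by (auto simp: P_def)
    ultimately show ?case using kobayashi_chain.step[of \<Omega> x "\<phi> n" "a n" _ "b n"] by simp
  qed
  have 2: "\<exists>n p \<phi> a b. c = (\<Sum>j<n. poincare_dist (a j) (b j)) \<and> P n p \<phi> a b y" if "kobayashi_chain \<Omega> x' y c" "x' = x" for x' y c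
    using that
  proof induction
    case (refl z)
    then show ?case by (intro exI[of _ 0] exI[of _ "\<lambda>_. x"]) (simp add: P_def)
  next
    case (step z \<phi>' a' c b')
    then obtain n p \<phi> a b where c: "c = (\<Sum>j<n. poincare_dist (a j) (b j))" and P: "P n p \<phi> a b (\<phi>' a')"
      by blast
    \<comment> \<open>\<open>P n\<close> reads \<open>p\<close> up to \<open>n\<close> and the other
      families below \<open>n\<close>, so these updates append one disc and leave the rest
      intact.\<close>
    have "P (Suc n) (p(Suc n := \<phi>' b')) (\<phi>(n := \<phi>')) (a(n := a')) (b(n := b')) (\<phi>' b')"
      using P step(2-4) unfolding P_def by (auto simp: less_Suc_eq)
    moreover have "(\<Sum>j<Suc n. poincare_dist ((a(n := a')) j) ((b(n := b')) j)) = c + poincare_dist a' b'"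
      unfolding c by simp
    ultimately show ?case by metis
  qed
  have "{\<Sum>j<n. poincare_dist (a j) (b j) | n p \<phi> a b. P n p \<phi> a b y} = {c. kobayashi_chain \<Omega> x y c}"
    using 1 2 by blast
  then show ?thesis using assms unfolding kobayashi_dist_def P_def by simp
qed

text \<open>Being joined by a chain is an equivalence relation with open classes, since affine discs
  reach all nearby points; connectedness leaves one class.\<close>

lemma kobayashi_chain_exists:
  assumes "open \<Omega>" "connected \<Omega>" "x \<in> \<Omega>" "y \<in> \<Omega>"
  shows "\<exists>c. kobayashi_chain \<Omega> x y c"
proof (rule connected_equivalence_relation[OF assms(2-4)])
  show "\<exists>c. kobayashi_chain \<Omega> y x c" if "\<exists>c. kobayashi_chain \<Omega> x y c" for x y
    using that kobayashi_chain_sym by blast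
  show "\<exists>c. kobayashi_chain \<Omega> x z c" if "\<exists>c. kobayashi_chain \<Omega> x y c" "\<exists>c. kobayashi_chain \<Omega> y z c" for x y z
    using that kobayashi_chain_trans by blast
  fix a assume "a \<in> \<Omega>"
  then obtain r where r: "r > 0" "ball a r \<subseteq> \<Omega>" using assms(1) open_contains_ball by blast
  have "\<exists>c. kobayashi_chain \<Omega> a z c" if z: "z \<in> ball a (r/2)" for z
  proof -
    \<comment> \<open>\<open>z\<close> is to be the value of the affine disc at the parameter 1/2;
      the radius \<open>r/2\<close> for \<open>z\<close> keeps \<open>norm w\<close> at most
      \<open>r\<close>.\<close>
    define w where "w = 2 *s (z - a)"
    have w: "norm w \<le> r"
      using z by (simp only: w_def norm_vector_smult) (simp add: dist_norm norm_minus_commute)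
    have "a + (1/2) *s w = z" by (simp only: w_def vector_smult_assoc) simp
    then show ?thesis
      using kobayashi_chain_disc[OF affine_disc(1)[OF r w], of 0 "1/2"] by (auto simp: norm_divide)
  qed
  then show "\<exists>T. openin (top_of_set \<Omega>) T \<and> a \<in> T \<and> (\<forall>x\<in>T. \<exists>c. kobayashi_chain \<Omega> a x c)"
    using r by (intro exI[of _ "ball a (r/2)"]) (auto simp: openin_open_eq assms(1))
qed

lemma bdd_below_chain_lengths: "bdd_below {c. kobayashi_chain \<Omega> x y c}"
  using kobayashi_chain_nonneg by (intro bdd_belowI[of _ 0]) auto

lemma kobayashi_dist_le:
  assumes "kobayashi_chain \<Omega> x y c" "x \<in> \<Omega>" "y \<in> \<Omega>"
  shows "kobayashi_dist \<Omega> x y \<le> c"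
  unfolding kobayashi_dist_eq[OF assms(2,3)]
  using assms(1) by (intro cInf_lower bdd_below_chain_lengths) auto

lemma kobayashi_dist_less:
  assumes "open \<Omega>" "connected \<Omega>" "x \<in> \<Omega>" "y \<in> \<Omega>" "kobayashi_dist \<Omega> x y < r"
  obtains c where "kobayashi_chain \<Omega> x y c" "c < r"
  using assms(5) kobayashi_chain_exists[OF assms(1-4)] unfolding kobayashi_dist_eq[OF assms(3,4)]
  by (subst (asm) cInf_less_iff[OF _ bdd_below_chain_lengths]) auto

text \<open>The points on the Poincare geodesics of the discs of a chain from \<open>x\<close> have Kobayashi distance
  at most the length of the chain from \<open>x\<close>; only the metric at such points matters.\<close>

lemma kobayashi_chain_displacement:
  assumes \<Omega>: "open \<Omega>" "bounded \<Omega>" and "kobayashi_chain \<Omega> x y c" "x \<in> \<Omega>" "c \<le> H" "0 \<le> m"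
    and "\<And>q v. q \<in> \<Omega> \<Longrightarrow> kobayashi_dist \<Omega> x q \<le> H \<Longrightarrow> norm v = 1 \<Longrightarrow> 1 / kobayashi_metric \<Omega> q v \<le> m"
  shows "norm (y - x) \<le> m * c"
  using assms(3-7)
proof induction
  case (step x \<phi> a c b)
  have pd: "0 \<le> poincare_dist a b" using step by (intro poincare_dist_nonneg) auto
  obtain \<psi> t where \<psi>: "\<psi> \<in> holomorphic_discs \<Omega>" and t: "0 \<le> t" "t < 1"
    and ab: "\<psi> 0 = \<phi> a" "\<psi> (of_real t) = \<phi> b" "poincare_dist a b = artanh t"
    using normalised_disc[OF step(2-4)] by blast
  have "norm (\<psi> (of_real t) - \<psi> 0) \<le> m * artanh t"
  proof (rule disc_displacement[OF \<Omega> \<psi> t \<open>0 \<le> m\<close>])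
    fix s and v :: "complex ^ 'a" assume s: "0 \<le> s" "s \<le> t" and v: "norm v = 1"
    have q: "\<psi> (of_real s) \<in> \<Omega>" using s t by (intro holomorphic_discsD(2)[OF \<psi>]) auto
    have "kobayashi_chain \<Omega> x (\<psi> (of_real s)) (c + poincare_dist 0 (of_real s))"
      using step(1) s t by (intro kobayashi_chain.step \<psi>) (auto simp: ab)
    then have "kobayashi_dist \<Omega> x (\<psi> (of_real s)) \<le> c + artanh s"
      using kobayashi_dist_le[OF _ \<open>x \<in> \<Omega>\<close> q] s by (simp add: poincare_dist_0)
    also have "\<dots> \<le> H" using artanh_mono[OF s t(2)] step.prems(2) ab(3) by simp
    finally show "1 / kobayashi_metric \<Omega> (\<psi> (of_real s)) v \<le> m" by (rule step.prems(4)[OF q _ v])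
  qed
  moreover have "norm (\<phi> a - x) \<le> m * c"
    using step.prems pd by (intro step.IH) auto
  moreover have "norm (\<phi> b - x) \<le> norm (\<phi> b - \<phi> a) + norm (\<phi> a - x)"
    using norm_triangle_ineq[of "\<phi> b - \<phi> a" "\<phi> a - x"] by simp
  ultimately show ?case by (simp add: ab distrib_left)
qed simp

section \<open>Comparison with the Euclidean distance\<close>

text \<open>A global bound \<open>C\<close> on the inverse metric feeds
  \<open>kobayashi_chain_displacement\<close>, with \<open>H\<close> the length of the chain itself,
  for every chain from \<open>x\<close> to \<open>y\<close>.\<close>

lemma norm_diff_le_kobayashi_dist:
  fixes \<Omega> :: "(complex ^ 'n) set"
  assumes "bounded_domain \<Omega>"
  obtains C where "C > 0" "\<And>x y. x \<in> \<Omega> \<Longrightarrow> y \<in> \<Omega> \<Longrightarrow> norm (y - x) \<le> C * kobayashi_dist \<Omega> x y"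
proof -
  have \<Omega>: "open \<Omega>" "connected \<Omega>" "bounded \<Omega>" using assms by (auto simp: bounded_domain_def)
  obtain C where C: "C > 0" "\<And>x v. x \<in> \<Omega> \<Longrightarrow> norm v = 1 \<Longrightarrow> 1 / C \<le> kobayashi_metric \<Omega> x v"
    using kobayashi_metric_lower_bound[OF \<Omega>(1,3)] by blast
  have C': "1 / kobayashi_metric \<Omega> x v \<le> C" if "x \<in> \<Omega>" "norm v = 1" for x v
    using C(2)[OF that] C(1) kobayashi_metric_pos[OF \<Omega>(1,3) that] by (simp add: field_simps)
  have "norm (y - x) \<le> C * kobayashi_dist \<Omega> x y" if xy: "x \<in> \<Omega>" "y \<in> \<Omega>" for x y
  proof -
    have "norm (y - x) / C \<le> kobayashi_dist \<Omega> x y"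
      unfolding kobayashi_dist_eq[OF xy]
    proof (rule cInf_greatest)
      show "{c. kobayashi_chain \<Omega> x y c} \<noteq> {}" using kobayashi_chain_exists[OF \<Omega>(1,2) xy] by simp
      show "norm (y - x) / C \<le> c" if "c \<in> {c. kobayashi_chain \<Omega> x y c}" for c
        using kobayashi_chain_displacement[OF \<Omega>(1,3), of x y c c C] that xy(1) C(1) C'
        by (simp add: field_simps)
    qed
    then show ?thesis using C(1) by (simp add: field_simps)
  qed
  then show ?thesis using C(1) that by blast
qed

text \<open>Comparison with the Euclidean norm gives nonnegativity and definiteness on
  \<open>\<Omega>\<close>; concatenating near-optimal chains gives the triangle inequality.\<close>

lemma Metric_space_kobayashi:
  assumes dom: "bounded_domain \<Omega>"
  shows "Metric_space \<Omega> (kobayashi_dist \<Omega>)"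
proof
  have \<Omega>: "open \<Omega>" "connected \<Omega>" "bounded \<Omega>" using assms by (auto simp: bounded_domain_def)
  obtain C where C: "C > 0" "\<And>x y. x \<in> \<Omega> \<Longrightarrow> y \<in> \<Omega> \<Longrightarrow> norm (y - x) \<le> C * kobayashi_dist \<Omega> x y"
    using norm_diff_le_kobayashi_dist[OF dom] by blast
  show nonneg: "0 \<le> kobayashi_dist \<Omega> x y" for x y
  proof (cases "x \<in> \<Omega> \<and> y \<in> \<Omega>")
    case True
    then have "0 \<le> C * kobayashi_dist \<Omega> x y" using C(2)[of x y] norm_ge_zero[of "y - x"] by linarith
    then show ?thesis using C(1) by (simp add: zero_le_mult_iff)
  qed (auto simp: kobayashi_dist_def)
  show "kobayashi_dist \<Omega> x y = kobayashi_dist \<Omega> y x" for x y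
  proof (cases "x \<in> \<Omega> \<and> y \<in> \<Omega>")
    case True
    have "kobayashi_chain \<Omega> x y c \<longleftrightarrow> kobayashi_chain \<Omega> y x c" for c
      using kobayashi_chain_sym by blast
    then show ?thesis using True by (simp add: kobayashi_dist_eq)
  qed (auto simp: kobayashi_dist_def)
  show "(kobayashi_dist \<Omega> x y = 0) = (x = y)" if "x \<in> \<Omega>" "y \<in> \<Omega>" for x y
  proof
    show "x = y" if "kobayashi_dist \<Omega> x y = 0" using C(2)[OF \<open>x \<in> \<Omega>\<close> \<open>y \<in> \<Omega>\<close>] that by simp
    show "kobayashi_dist \<Omega> x y = 0" if "x = y"
      using kobayashi_dist_le[OF kobayashi_chain.refl] nonneg[of x x] \<open>x \<in> \<Omega>\<close> that by (metis order_antisym)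
  qed
  show "kobayashi_dist \<Omega> x z \<le> kobayashi_dist \<Omega> x y + kobayashi_dist \<Omega> y z"
    if xyz: "x \<in> \<Omega>" "y \<in> \<Omega>" "z \<in> \<Omega>" for x y z
  proof (rule field_le_epsilon)
    fix e :: real assume "0 < e"
    obtain c where c: "kobayashi_chain \<Omega> x y c" "c < kobayashi_dist \<Omega> x y + e/2"
      using kobayashi_dist_less[OF \<Omega>(1,2) xyz(1,2)] \<open>0 < e\<close> by (metis half_gt_zero less_add_same_cancel1)
    obtain c' where c': "kobayashi_chain \<Omega> y z c'" "c' < kobayashi_dist \<Omega> y z + e/2"
      using kobayashi_dist_less[OF \<Omega>(1,2) xyz(2,3)] \<open>0 < e\<close> by (metis half_gt_zero less_add_same_cancel1)
    have "kobayashi_dist \<Omega> x z \<le> c + c'"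
      using kobayashi_dist_le[OF kobayashi_chain_trans[OF c'(1) c(1)] xyz(1,3)] .
    then show "kobayashi_dist \<Omega> x z \<le> kobayashi_dist \<Omega> x y + kobayashi_dist \<Omega> y z + e"
      using c(2) c'(2) by linarith
  qed
qed

text \<open>The Kobayashi ball of radius \<open>e / C\<close> lies in the Euclidean ball of radius
  \<open>e\<close>. Through this map \<open>F\<close> becomes continuous into Euclidean
  space.\<close>

lemma continuous_map_kobayashi_euclidean:
  assumes dom: "bounded_domain \<Omega>"
  shows "continuous_map (Metric_space.mtopology \<Omega> (kobayashi_dist \<Omega>)) euclidean (\<lambda>x. x)"
proof -
  interpret Metric_space \<Omega> "kobayashi_dist \<Omega>" by (rule Metric_space_kobayashi[OF dom])
  obtain C where C: "C > 0" "\<And>x y. x \<in> \<Omega> \<Longrightarrow> y \<in> \<Omega> \<Longrightarrow> norm (y - x) \<le> C * kobayashi_dist \<Omega> x y"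
    using norm_diff_le_kobayashi_dist[OF dom] by blast
  have "openin mtopology {x \<in> \<Omega>. x \<in> U}" if "open U" for U
    unfolding openin_mtopology
  proof (intro conjI allI impI)
    fix x assume "x \<in> {x \<in> \<Omega>. x \<in> U}"
    then obtain e where x: "x \<in> \<Omega>" and e: "e > 0" "ball x e \<subseteq> U" using \<open>open U\<close> open_contains_ball by blast
    have "mball x (e / C) \<subseteq> {x \<in> \<Omega>. x \<in> U}"
    proof
      fix y assume y: "y \<in> mball x (e / C)"
      then have "norm (y - x) < e" using C(2)[of x y] C(1) by (simp add: field_simps)
      then have "y \<in> ball x e" by (simp add: dist_norm norm_minus_commute)
      then show "y \<in> {x \<in> \<Omega>. x \<in> U}" using y e by auto
    qed
    then show "\<exists>r>0. mball x r \<subseteq> {x \<in> \<Omega>. x \<in> U}" using e C(1) by (intro exI[of _ "e / C"]) simp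
  qed auto
  then show ?thesis by (simp add: continuous_map_def)
qed

section \<open>Visibility of Goldilocks domains\<close>

text \<open>Condensation on geometric scales: for \<open>r\<close> between \<open>B q^(k+1)\<close>
  and \<open>B q^k\<close> monotonicity gives \<open>f r / r \<ge> f (B q^(k+1)) / (B q^k)\<close>,
  so this interval contributes at least \<open>(1 - q) f (B q^(k+1))\<close> to the
  integral.\<close>

lemma summable_of_dlog_integral:
  fixes f :: "real \<Rightarrow> real"
  assumes fin: "(\<integral>\<^sup>+ r \<in> {0<..<\<epsilon>}. ennreal (1 / r * f r) \<partial>lborel) < \<infinity>" and "\<epsilon> > 0"
    and nonneg: "\<And>r. 0 < r \<Longrightarrow> 0 \<le> f r" and mono: "\<And>r s. 0 < r \<Longrightarrow> r \<le> s \<Longrightarrow> f r \<le> f s"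
    and "A > 0" and q: "0 < q" "q < 1"
  shows "summable (\<lambda>k. f (A * q ^ k))"
proof -
  \<comment> \<open>Starting at a scale \<open>A q^n0\<close> below \<open>\<epsilon>\<close> puts
    all the intervals inside the range of integration.\<close>
  have "(\<lambda>n. A * q ^ n) \<longlonglongrightarrow> A * 0" using q by (intro tendsto_intros LIMSEQ_realpow_zero) auto
  then have "\<forall>\<^sub>F n in sequentially. A * q ^ n < \<epsilon>" using \<open>\<epsilon> > 0\<close> by (intro order_tendstoD) auto
  then obtain n0 where n0: "A * q ^ n0 < \<epsilon>" using eventually_happens by fastforce
  define B where "B = A * q ^ n0"
  have B: "B > 0" "B < \<epsilon>" using n0 \<open>A > 0\<close> q by (auto simp: B_def)
  \<comment> \<open>Open intervals share no endpoints, so at most one term of the step function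
    below is nonzero at any \<open>r\<close>.\<close>
  define I where "I k = {B * q ^ Suc k<..<B * q ^ k}" for k
  define c where "c k = f (B * q ^ Suc k) / (B * q ^ k)" for k
  have Bq: "0 < B * q ^ k" for k using B q by simp
  have c0: "0 \<le> c k" for k unfolding c_def using nonneg[OF Bq] Bq less_imp_le divide_nonneg_pos by blast
  let ?F = "\<lambda>r. ennreal (1 / r * f r) * indicator {0<..<\<epsilon>} r"
  have disj: "j = k" if "r \<in> I j" "r \<in> I k" for r j k
  proof -
    have "\<not> j < k" if "r \<in> I j" "r \<in> I k" for j k
    proof
      assume "j < k"
      then have "B * q ^ k \<le> B * q ^ Suc j" using q B by (intro mult_left_mono power_decreasing) auto
      then show False using that by (auto simp: I_def)
    qed
    then show ?thesis using that by (metis linorder_neqE_nat)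
  qed
  have le: "(\<Sum>k<n. ennreal (c k) * indicator (I k) r) \<le> ?F r" for n r
  proof (cases "\<exists>k<n. r \<in> I k")
    case True
    then obtain k where k: "k < n" "r \<in> I k" by blast
    have "(\<Sum>j<n. ennreal (c j) * indicator (I j) r) = (\<Sum>j\<in>{k}. ennreal (c j) * indicator (I j) r)"
      using k disj by (intro sum.mono_neutral_right) (auto simp: indicator_def)
    also have "\<dots> = ennreal (c k)" using k by simp
    also have "\<dots> \<le> ennreal (1 / r * f r)"
    proof (rule ennreal_leI)
      have r: "B * q ^ Suc k < r" "r < B * q ^ k" using k by (auto simp: I_def)
      have "0 < r" using r Bq[of "Suc k"] by linarith
      have "f (B * q ^ Suc k) / (B * q ^ k) \<le> f r / r"
        using r \<open>0 < r\<close> mono[OF Bq, of "Suc k" r] nonneg[OF Bq, of "Suc k"] by (intro frac_le) auto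
      then show "c k \<le> 1 / r * f r" by (simp add: c_def)
    qed
    also have "\<dots> = ?F r"
    proof -
      have r: "B * q ^ Suc k < r" "r < B * q ^ k" using k by (auto simp: I_def)
      moreover have "B * q ^ k \<le> B * 1" using q B by (intro mult_left_mono power_le_one) auto
      ultimately have "0 < r" "r < \<epsilon>" using Bq[of "Suc k"] B by linarith+
      then show ?thesis by (simp add: indicator_def)
    qed
    finally show ?thesis .
  next
    case False
    then have "(\<Sum>j<n. ennreal (c j) * indicator (I j) r) = 0" by (intro sum.neutral) auto
    then show ?thesis by simp
  qed
  have sum_le: "(\<Sum>k<n. ennreal ((1 - q) * f (B * q ^ Suc k))) \<le> (\<integral>\<^sup>+ r. ?F r \<partial>lborel)" for n
  proof -
    have "ennreal ((1 - q) * f (B * q ^ Suc k)) = ennreal (c k) * emeasure lborel (I k)" for k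
    proof -
      have "B * q ^ Suc k \<le> B * q ^ k" using q B by (intro mult_left_mono power_decreasing) auto
      then have "ennreal (c k) * emeasure lborel (I k) = ennreal (c k * (B * q ^ k - B * q ^ Suc k))"
        using c0 by (simp add: I_def ennreal_mult)
      also have "c k * (B * q ^ k - B * q ^ Suc k) = (1 - q) * f (B * q ^ Suc k)"
        using B q by (simp add: c_def field_simps)
      finally show ?thesis by simp
    qed
    then have "(\<Sum>k<n. ennreal ((1 - q) * f (B * q ^ Suc k))) = (\<Sum>k<n. \<integral>\<^sup>+ r. ennreal (c k) * indicator (I k) r \<partial>lborel)"
      by (simp add: nn_integral_cmult_indicator I_def)
    also have "\<dots> = (\<integral>\<^sup>+ r. (\<Sum>k<n. ennreal (c k) * indicator (I k) r) \<partial>lborel)"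
      by (rule nn_integral_sum[symmetric]) (simp add: I_def)
    also have "\<dots> \<le> (\<integral>\<^sup>+ r. ?F r \<partial>lborel)" by (intro nn_integral_mono le)
    finally show ?thesis .
  qed
  obtain J where J: "0 \<le> J" "(\<integral>\<^sup>+ r. ?F r \<partial>lborel) = ennreal J"
    using fin by (cases "\<integral>\<^sup>+ r. ?F r \<partial>lborel" rule: ennreal_cases) auto
  have nn: "0 \<le> (1 - q) * f (B * q ^ Suc k)" for k
    using q by (intro mult_nonneg_nonneg nonneg Bq) auto
  have "summable (\<lambda>k. (1 - q) * f (B * q ^ Suc k))"
  proof (rule summableI_nonneg_bounded)
    show "0 \<le> (1 - q) * f (B * q ^ Suc k)" for k by (rule nn)
    have "ennreal (\<Sum>k<n. (1 - q) * f (B * q ^ Suc k)) \<le> ennreal J" for n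
      using sum_le[of n] nn unfolding J(2) by (subst (asm) sum_ennreal) auto
    then show "(\<Sum>k<n. (1 - q) * f (B * q ^ Suc k)) \<le> J" for n
      using J(1) by (simp add: ennreal_le_iff)
  qed
  then have "summable (\<lambda>k. f (B * q ^ Suc k))"
    using q by simp
  \<comment> \<open>The series so far is a tail of the required one; finitely many missing terms do
    not affect convergence.\<close>
  moreover have "B * q ^ Suc k = A * q ^ (k + Suc n0)" for k
    by (simp add: B_def power_add mult_ac)
  ultimately have "summable (\<lambda>k. f (A * q ^ (k + Suc n0)))" by (simp only:)
  then show ?thesis by (rule iffD1[OF summable_iff_shift[of "\<lambda>k. f (A * q ^ k)" "Suc n0"]])
qed

text \<open>With truncated subtraction \<open>(j - i) + (i - j)\<close> is the distance
  \<open>|i - j|\<close>; each distance occurs at most once on either side of \<open>i\<close>,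
  hence the factor 2.\<close>

lemma sum_around_le:
  fixes h :: "nat \<Rightarrow> real"
  assumes h: "summable h" "\<And>k. 0 \<le> h k"
  shows "(\<Sum>j<N. h ((j - i) + (i - j))) \<le> 2 * suminf h"
proof -
  let ?L = "{j. j < N \<and> j < i}" and ?R = "{j. j < N \<and> i \<le> j}"
  have "(\<Sum>j<N. h ((j - i) + (i - j))) = (\<Sum>j\<in>?L \<union> ?R. h ((j - i) + (i - j)))"
    by (rule sum.cong) auto
  also have "\<dots> = (\<Sum>j\<in>?L. h ((j - i) + (i - j))) + (\<Sum>j\<in>?R. h ((j - i) + (i - j)))"
    by (rule sum.union_disjoint) auto
  also have "(\<Sum>j\<in>?L. h ((j - i) + (i - j))) = sum h ((\<lambda>j. i - j) ` ?L)"
    by (subst sum.reindex) (auto simp: inj_on_def)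
  also have "(\<Sum>j\<in>?R. h ((j - i) + (i - j))) = sum h ((\<lambda>j. j - i) ` ?R)"
    by (subst sum.reindex) (auto simp: inj_on_def)
  finally show ?thesis
    using sum_le_suminf[OF h(1), of "(\<lambda>j. i - j) ` ?L"] sum_le_suminf[OF h(1), of "(\<lambda>j. j - i) ` ?R"] h(2)
    by simp
qed

section \<open>Boundedness, sign and monotonicity of \<open>M_fun\<close>\<close>

lemma M_fun_bdd_above:
  assumes "bounded_domain \<Omega>"
  shows "bdd_above {1 / kobayashi_metric \<Omega> x v | x v. x \<in> \<Omega> \<and> boundary_dist \<Omega> x \<le> r \<and> norm v = 1}"
proof -
  have \<Omega>: "open \<Omega>" "bounded \<Omega>" using assms by (auto simp: bounded_domain_def)
  obtain C where C: "C > 0" "\<And>x v. x \<in> \<Omega> \<Longrightarrow> norm v = 1 \<Longrightarrow> 1 / C \<le> kobayashi_metric \<Omega> x v"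
    using kobayashi_metric_lower_bound[OF \<Omega>] by blast
  have "1 / kobayashi_metric \<Omega> x v \<le> C" if "x \<in> \<Omega>" "norm v = 1" for x v
    using C(2)[OF that] C(1) kobayashi_metric_pos[OF \<Omega> that] by (simp add: field_simps)
  then show ?thesis by (intro bdd_aboveI[of _ C]) auto
qed

lemma inverse_kobayashi_metric_le_M_fun:
  assumes "bounded_domain \<Omega>" "x \<in> \<Omega>" "boundary_dist \<Omega> x \<le> r" "norm v = 1"
  shows "1 / kobayashi_metric \<Omega> x v \<le> M_fun \<Omega> r"
  unfolding M_fun_def using assms by (intro cSup_upper M_fun_bdd_above) auto

text \<open>This keeps the supremum in \<open>M_fun\<close> from being taken over the empty set when
  \<open>r > 0\<close>.\<close>

lemma exists_near_boundary:
  assumes "bounded_domain \<Omega>" "r > 0"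
  shows "\<exists>x\<in>\<Omega>. boundary_dist \<Omega> x \<le> r"
proof (cases "frontier \<Omega> = {}")
  case True
  \<comment> \<open>\<open>infdist\<close> to the empty set is 0 by convention, so any point of
    \<open>\<Omega>\<close> serves.\<close>
  then show ?thesis using assms by (auto simp: bounded_domain_def boundary_dist_def infdist_def)
next
  case False
  then obtain y where y: "y \<in> frontier \<Omega>" by blast
  then have "y \<in> closure \<Omega>" by (simp add: frontier_def)
  then obtain x where x: "x \<in> \<Omega>" "dist x y < r" using assms(2) closure_approachable by blast
  have "boundary_dist \<Omega> x \<le> dist x y" unfolding boundary_dist_def by (rule infdist_le[OF y])
  then show ?thesis using x by (intro bexI[of _ x]) auto
qed

lemma M_fun_nonneg:
  fixes \<Omega> :: "(complex ^ 'a) set"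
  assumes "bounded_domain \<Omega>" "r > 0"
  shows "0 \<le> M_fun \<Omega> r"
proof -
  have \<Omega>: "open \<Omega>" "bounded \<Omega>" using assms by (auto simp: bounded_domain_def)
  obtain x where x: "x \<in> \<Omega>" "boundary_dist \<Omega> x \<le> r"
    using exists_near_boundary[OF assms] by blast
  obtain v :: "complex ^ 'a" where v: "norm v = 1" using vector_choose_size[of 1] by auto
  have "0 \<le> 1 / kobayashi_metric \<Omega> x v"
    using kobayashi_metric_pos[OF \<Omega> x(1) v] by simp
  also have "\<dots> \<le> M_fun \<Omega> r" by (rule inverse_kobayashi_metric_le_M_fun[OF assms(1) x v])
  finally show ?thesis .
qed

lemma M_fun_mono:
  fixes \<Omega> :: "(complex ^ 'a) set"
  assumes "bounded_domain \<Omega>" "0 < r" "r \<le> s"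
  shows "M_fun \<Omega> r \<le> M_fun \<Omega> s"
  unfolding M_fun_def
proof (rule cSup_subset_mono[OF _ M_fun_bdd_above[OF assms(1)]])
  obtain v :: "complex ^ 'a" where "norm v = 1" using vector_choose_size[of 1] by auto
  then show "{1 / kobayashi_metric \<Omega> x v |x v. x \<in> \<Omega> \<and> boundary_dist \<Omega> x \<le> r \<and> norm v = 1} \<noteq> {}"
    using exists_near_boundary[OF assms(1,2)] by blast
  show "{1 / kobayashi_metric \<Omega> x v |x v. x \<in> \<Omega> \<and> boundary_dist \<Omega> x \<le> r \<and> norm v = 1}
      \<subseteq> {1 / kobayashi_metric \<Omega> x v |x v. x \<in> \<Omega> \<and> boundary_dist \<Omega> x \<le> s \<and> norm v = 1}"
    using assms(3) by (blast intro: order_trans)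
qed

lemma summable_M_fun:
  assumes "goldilocks_domain \<Omega>" "A > 0" "0 < q" "q < 1"
  shows "summable (\<lambda>k. M_fun \<Omega> (A * q ^ k))"
proof -
  have dom: "bounded_domain \<Omega>" using assms(1) by (simp add: goldilocks_domain_def)
  obtain \<epsilon> where \<epsilon>: "\<epsilon> > 0" "(\<integral>\<^sup>+ r \<in> {0<..<\<epsilon>}. ennreal (1 / r * M_fun \<Omega> r) \<partial>lborel) < \<infinity>"
    using assms(1) unfolding goldilocks_domain_def by blast
  show ?thesis
    by (rule summable_of_dlog_integral[OF \<epsilon>(2,1) M_fun_nonneg[OF dom] M_fun_mono[OF dom] assms(2-4)])
qed

section \<open>Displacement along paths far from the base point\<close>

text \<open>The second Goldilocks condition, solved for the boundary distance.\<close>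

lemma goldilocks_boundary_dist_le:
  assumes "goldilocks_domain \<Omega>" "x0 \<in> \<Omega>"
  obtains C \<alpha> where "\<alpha> > 0" "\<And>x. x \<in> \<Omega> \<Longrightarrow> boundary_dist \<Omega> x \<le> exp ((C - kobayashi_dist \<Omega> x0 x) / \<alpha>)"
proof -
  obtain C \<alpha> where C: "\<alpha> > 0" "\<And>x. x \<in> \<Omega> \<Longrightarrow> kobayashi_dist \<Omega> x0 x \<le> C + \<alpha> * ln (1 / boundary_dist \<Omega> x)"
    using assms unfolding goldilocks_domain_def by blast
  have "boundary_dist \<Omega> x \<le> exp ((C - kobayashi_dist \<Omega> x0 x) / \<alpha>)" if x: "x \<in> \<Omega>" for x
  proof (cases "boundary_dist \<Omega> x > 0")
    case True
    have "ln (boundary_dist \<Omega> x) \<le> (C - kobayashi_dist \<Omega> x0 x) / \<alpha>"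
      using C(2)[OF x] C(1) True by (simp add: ln_div field_simps)
    then show ?thesis using True by (metis exp_le_cancel_iff exp_ln)
  next
    case False
    \<comment> \<open>The exponential is positive, so it bounds a boundary distance at which the
      logarithm says nothing.\<close>
    then show ?thesis by (meson exp_ge_zero not_less order_trans)
  qed
  then show ?thesis using C(1) that by blast
qed

text \<open>Points within \<open>H\<close> of \<open>w j\<close> are still at distance at least
  \<open>b n - c - H\<close> from \<open>x0\<close>, where \<open>n\<close> is \<open>n j\<close>,
  so their boundary distance is at most \<open>A q^n\<close> and \<open>M_fun\<close> bounds the
  step by \<open>g (n j)\<close>. As \<open>g\<close> is chosen before the path, the estimate is
  uniform in all paths.\<close>

lemma goldilocks_path_displacement:
  assumes gold: "goldilocks_domain \<Omega>" and x0: "x0 \<in> \<Omega>" and b: "b > 0" and H: "H \<ge> 0"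
  shows "\<exists>g :: nat \<Rightarrow> real. summable g \<and> (\<forall>k. 0 \<le> g k) \<and>
    (\<forall>N w n. (\<forall>j\<le>N. w j \<in> \<Omega>) \<longrightarrow> (\<forall>j<N. kobayashi_dist \<Omega> (w j) (w (Suc j)) < H) \<longrightarrow>
      (\<forall>j<N. b * real (n j) - c \<le> kobayashi_dist \<Omega> x0 (w j)) \<longrightarrow>
      norm (w N - w 0) \<le> (\<Sum>j<N. g (n j)))"
proof -
  have dom: "bounded_domain \<Omega>" using gold by (simp add: goldilocks_domain_def)
  then have \<Omega>: "open \<Omega>" "connected \<Omega>" "bounded \<Omega>" by (auto simp: bounded_domain_def)
  interpret Metric_space \<Omega> "kobayashi_dist \<Omega>" by (rule Metric_space_kobayashi[OF dom])
  obtain C \<alpha> where C: "\<alpha> > 0" "\<And>x. x \<in> \<Omega> \<Longrightarrow> boundary_dist \<Omega> x \<le> exp ((C - kobayashi_dist \<Omega> x0 x) / \<alpha>)"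
    using goldilocks_boundary_dist_le[OF gold x0] by blast
  \<comment> \<open>\<open>A q^n\<close> is the bound \<open>exp ((C - K) / \<alpha>)\<close> at the
    distance \<open>K = b n - c - H\<close>.\<close>
  define A where "A = exp ((C + c + H) / \<alpha>)"
  define q where "q = exp (- b / \<alpha>)"
  define g where "g n = M_fun \<Omega> (A * q ^ n) * H" for n
  have Aq: "A > 0" "0 < q" "q < 1" using b C(1) by (auto simp: A_def q_def)
  have M0: "0 \<le> M_fun \<Omega> (A * q ^ n)" for n using Aq by (intro M_fun_nonneg[OF dom]) simp
  have disp: "norm (w N - w 0) \<le> (\<Sum>j<N. g (n j))"
    if w: "\<And>j. j \<le> N \<Longrightarrow> w j \<in> \<Omega>" and steps: "\<And>j. j < N \<Longrightarrow> kobayashi_dist \<Omega> (w j) (w (Suc j)) < H"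
      and far: "\<And>j. j < N \<Longrightarrow> b * real (n j) - c \<le> kobayashi_dist \<Omega> x0 (w j)" for N w n
  proof -
    have "norm (w (Suc j) - w j) \<le> g (n j)" if j: "j < N" for j
    proof -
      have wj: "w j \<in> \<Omega>" "w (Suc j) \<in> \<Omega>" using w j by auto
      obtain L where L: "kobayashi_chain \<Omega> (w j) (w (Suc j)) L" "L < H"
        using kobayashi_dist_less[OF \<Omega>(1,2) wj steps[OF j]] by blast
      \<comment> \<open>The chain is shorter than \<open>H\<close>, so only points within
        \<open>H\<close> of \<open>w j\<close> have to be controlled.\<close>
      have "norm (w (Suc j) - w j) \<le> M_fun \<Omega> (A * q ^ n j) * L"
      proof (rule kobayashi_chain_displacement[OF \<Omega>(1,3) L(1) wj(1) less_imp_le[OF L(2)] M0])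
        fix z v :: "complex ^ 'a"
        assume z: "z \<in> \<Omega>" "kobayashi_dist \<Omega> (w j) z \<le> H" and v: "norm v = 1"
        have "kobayashi_dist \<Omega> x0 (w j) \<le> kobayashi_dist \<Omega> x0 z + kobayashi_dist \<Omega> z (w j)"
          using triangle[OF x0 z(1) wj(1)] .
        then have "b * real (n j) - c - H \<le> kobayashi_dist \<Omega> x0 z"
          using far[OF j] z(2) commute[of z "w j"] by linarith
        then have "(C - kobayashi_dist \<Omega> x0 z) / \<alpha> \<le> (C + c + H - b * real (n j)) / \<alpha>"
          using C(1) by (intro divide_right_mono) auto
        also have "\<dots> = (C + c + H) / \<alpha> + real (n j) * (- b / \<alpha>)"
          by (simp add: diff_divide_distrib mult.commute)
        finally have "exp ((C - kobayashi_dist \<Omega> x0 z) / \<alpha>) \<le> A * q ^ n j"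
          unfolding A_def q_def exp_of_nat_mult[symmetric] exp_add[symmetric] by simp
        then have "boundary_dist \<Omega> z \<le> A * q ^ n j" using C(2)[OF z(1)] by linarith
        then show "1 / kobayashi_metric \<Omega> z v \<le> M_fun \<Omega> (A * q ^ n j)"
          by (intro inverse_kobayashi_metric_le_M_fun[OF dom z(1) _ v])
      qed
      also have "\<dots> \<le> g (n j)" unfolding g_def using L(2) M0 by (intro mult_left_mono) auto
      finally show ?thesis .
    qed
    then have "norm (\<Sum>j<N. w (Suc j) - w j) \<le> (\<Sum>j<N. g (n j))" by (intro sum_norm_le) auto
    then show ?thesis by (simp only: sum_lessThan_telescope)
  qed
  have "summable g" unfolding g_def by (intro summable_mult2 summable_M_fun[OF gold Aq])
  moreover have "\<forall>k. 0 \<le> g k" unfolding g_def using M0 H by simp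
  moreover have "\<forall>N w n. (\<forall>j\<le>N. w j \<in> \<Omega>) \<longrightarrow> (\<forall>j<N. kobayashi_dist \<Omega> (w j) (w (Suc j)) < H) \<longrightarrow>
      (\<forall>j<N. b * real (n j) - c \<le> kobayashi_dist \<Omega> x0 (w j)) \<longrightarrow>
      norm (w N - w 0) \<le> (\<Sum>j<N. g (n j))"
  proof (intro allI impI)
    fix N w n
    assume "\<forall>j\<le>N. w j \<in> \<Omega>" "\<forall>j<N. kobayashi_dist \<Omega> (w j) (w (Suc j)) < H"
      "\<forall>j<N. b * real (n j) - c \<le> kobayashi_dist \<Omega> x0 (w j)"
    then show "norm (w N - w 0) \<le> (\<Sum>j<N. g (n j))" by (intro disp[of N w n]) auto
  qed
  ultimately show ?thesis by (intro exI[of _ g] conjI)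
qed

text \<open>Provides \<open>vis\<close> for \<open>gromov_extension\<close>. \<open>R\<close> can be
  fixed before \<open>x\<close> and \<open>y\<close> because the series \<open>g\<close> depends
  only on \<open>\<Omega>\<close>, on \<open>F p\<close> and on the quasi-isometry
  constants.\<close>

lemma goldilocks_visibility:
  assumes X: "Metric_space X d" and geo: "geodesic_space X d" and gold: "goldilocks_domain \<Omega>"
    and qi: "quasi_isometric_embedding X d \<Omega> (kobayashi_dist \<Omega>) F" and p: "p \<in> X" and "\<epsilon> > 0"
  shows "\<exists>R. \<forall>x\<in>X. \<forall>y\<in>X. gromov_product d p x y \<ge> R \<longrightarrow> dist (F x) (F y) \<le> \<epsilon>"
proof -
  interpret X: Metric_space X d by (rule X)
  have dom: "bounded_domain \<Omega>" using gold by (simp add: goldilocks_domain_def)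
  interpret K: Metric_space \<Omega> "kobayashi_dist \<Omega>" by (rule Metric_space_kobayashi[OF dom])
  let ?K = "kobayashi_dist \<Omega>"
  obtain l \<kappa> where l: "l \<ge> 1" and \<kappa>: "\<kappa> \<ge> 0" and F: "\<And>x. x \<in> X \<Longrightarrow> F x \<in> \<Omega>"
    and qi1: "\<And>x y. x \<in> X \<Longrightarrow> y \<in> X \<Longrightarrow> 1 / l * ?K (F x) (F y) - \<kappa> \<le> d x y"
    and qi2: "\<And>x y. x \<in> X \<Longrightarrow> y \<in> X \<Longrightarrow> d x y \<le> l * ?K (F x) (F y) + \<kappa>"
    using qi unfolding quasi_isometric_embedding_def by blast
  \<comment> \<open>Adding the three estimates below gives
    \<open>R + |i - j| \<le> 3 l K + 2 \<kappa> + 1\<close>, with \<open>K\<close> the distance from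
    \<open>F p\<close> to \<open>w j\<close>; this dictates \<open>b\<close> and \<open>c\<close>. A
    step of length at most 1 has an image of length at most \<open>l (1 + \<kappa>)\<close>; the
    extra 1 in \<open>H\<close> makes the inequality strict.\<close>
  define b where "b = 1 / (3 * l)"
  define c where "c = (2 * \<kappa> + 1) / (3 * l)"
  define H where "H = l * (1 + \<kappa>) + 1"
  have bH: "b > 0" "H \<ge> 0" using l \<kappa> by (auto simp: b_def H_def)
  obtain g :: "nat \<Rightarrow> real" where g: "summable g" "\<forall>k. 0 \<le> g k"
    and disp: "\<forall>N w n. (\<forall>j\<le>N. w j \<in> \<Omega>) \<longrightarrow> (\<forall>j<N. ?K (w j) (w (Suc j)) < H) \<longrightarrow>
      (\<forall>j<N. b * real (n j) - c \<le> ?K (F p) (w j)) \<longrightarrow> norm (w N - w 0) \<le> (\<Sum>j<N. g (n j))"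
    using goldilocks_path_displacement[OF gold F[OF p] bH, of c] by (elim exE conjE) (rule that)
  \<comment> \<open>The factor 2 is the one lost in \<open>sum_around_le\<close>.\<close>
  obtain R where R: "2 * (\<Sum>k. g (k + R)) < \<epsilon>"
  proof -
    obtain R where "norm (\<Sum>k. g (k + R)) < \<epsilon> / 2"
      using suminf_exist_split[OF _ g(1), of "\<epsilon> / 2"] \<open>\<epsilon> > 0\<close> by auto
    then show ?thesis by (intro that[of R]) simp
  qed
  have "dist (F x) (F y) \<le> \<epsilon>" if x: "x \<in> X" and y: "y \<in> X" and xy: "gromov_product d p x y \<ge> real R" for x y
  proof -
    define L where "L = d x y"
    have L: "0 \<le> L" by (simp add: L_def)
    obtain \<sigma> :: "real \<Rightarrow> 'a" where \<sigma>X: "\<sigma> ` {0..L} \<subseteq> X" and \<sigma>0: "\<sigma> 0 = x" "\<sigma> L = y"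
      and \<sigma>: "\<forall>s\<in>{0..L}. \<forall>t\<in>{0..L}. d (\<sigma> s) (\<sigma> t) = \<bar>s - t\<bar>"
      using geo[unfolded geodesic_space_def, rule_format, OF x y] unfolding L_def[symmetric]
      by (elim exE conjE) (rule that)
    define N where "N = nat \<lceil>L\<rceil>"
    have N: "L \<le> real N" "real N < L + 1" using L unfolding N_def by linarith+
    \<comment> \<open>Cutting off at \<open>L\<close> makes the sample \<open>N\<close> the endpoint
      \<open>y\<close>; the last step may be shorter than 1.\<close>
    define z where "z j = \<sigma> (min (real j) L)" for j :: nat
    have z: "z j \<in> X" for j unfolding z_def using L \<sigma>X by auto
    have dz: "d (z i) (z j) = \<bar>min (real i) L - min (real j) L\<bar>" for i j
      unfolding z_def using L by (intro \<sigma>[rule_format]) auto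
    define w where "w j = F (z j)" for j
    have w: "w j \<in> \<Omega>" for j unfolding w_def by (intro F z)
    have zR: "real R \<le> d p (z j)" for j
    proof -
      \<comment> \<open>\<open>z j\<close> lies on the geodesic, so two triangle inequalities
        through it bound the Gromov product by \<open>d p (z j)\<close>.\<close>
      have "d x (z j) + d (z j) y = L"
        using \<sigma>[rule_format, of 0 "min (real j) L"] \<sigma>[rule_format, of "min (real j) L" L] L by (simp add: z_def \<sigma>0)
      moreover have "d x p \<le> d x (z j) + d p (z j)" "d p y \<le> d p (z j) + d (z j) y"
        using X.triangle[OF x z p, of j] X.triangle[OF p z y, of j] X.commute[of p "z j"] by auto
      ultimately show ?thesis using xy by (simp add: gromov_product_def L_def field_simps)
    qed
    obtain i where i: "i \<le> N" "\<And>j. j \<le> N \<Longrightarrow> ?K (F p) (w i) \<le> ?K (F p) (w j)"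
      using arg_min_if_finite[of "{..N}" "\<lambda>j. ?K (F p) (w j)"] by (auto simp: not_less)
    have "norm (w N - w 0) \<le> (\<Sum>j<N. g (((j - i) + (i - j)) + R))"
    proof (rule disp[rule_format, of N w "\<lambda>j. ((j - i) + (i - j)) + R"])
      fix j assume j: "j < N"
      have "d (z j) (z (Suc j)) \<le> 1" unfolding dz by linarith
      then have "1 / l * ?K (w j) (w (Suc j)) \<le> 1 + \<kappa>" using qi1[OF z z, of j "Suc j"] by (simp add: w_def)
      then show "?K (w j) (w (Suc j)) < H" using l by (simp add: H_def field_simps)
      \<comment> \<open>Since \<open>w i\<close> is nearest to \<open>F p\<close>, going through
        \<open>F p\<close> costs at most twice the distance from \<open>F p\<close> to
        \<open>w j\<close>. Separation of the samples thus forces distance from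
        \<open>F p\<close>.\<close>
      have "?K (w i) (w j) \<le> ?K (F p) (w i) + ?K (F p) (w j)"
        using K.triangle[OF w F[OF p] w, of i j] K.commute[of "F p" "w i"] by simp
      then have "?K (w i) (w j) \<le> 2 * ?K (F p) (w j)" using i(2)[of j] j by simp
      then have "l * ?K (w i) (w j) \<le> l * (2 * ?K (F p) (w j))" using l by (intro mult_left_mono) auto
      then have "d (z i) (z j) \<le> 2 * (l * ?K (F p) (w j)) + \<kappa>"
        using qi2[OF z z, of i j] by (simp add: w_def)
      \<comment> \<open>Only the sample \<open>N\<close> can be off its integer time, and by less
        than 1.\<close>
      moreover have "\<bar>real i - real j\<bar> - 1 \<le> d (z i) (z j)"
        unfolding dz using N i(1) j by linarith
      moreover have "real R \<le> l * ?K (F p) (w j) + \<kappa>"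
        using zR[of j] qi2[OF p z, of j] by (simp add: w_def)
      moreover have "real ((j - i) + (i - j)) = \<bar>real i - real j\<bar>" by (simp add: of_nat_diff abs_if)
      ultimately have "real ((j - i) + (i - j) + R) - (2 * \<kappa> + 1) \<le> 3 * l * ?K (F p) (w j)" by simp
      moreover have "b * real ((j - i) + (i - j) + R) - c = (real ((j - i) + (i - j) + R) - (2 * \<kappa> + 1)) / (3 * l)"
        by (simp add: b_def c_def diff_divide_distrib)
      ultimately show "b * real ((j - i) + (i - j) + R) - c \<le> ?K (F p) (w j)"
        using l by (simp add: pos_divide_le_eq mult.commute)
    qed (rule w)
    also have "\<dots> \<le> 2 * (\<Sum>k. g (k + R))"
      by (rule sum_around_le) (use g summable_ignore_initial_segment in auto)
    finally have "norm (w N - w 0) \<le> \<epsilon>" using R by linarith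
    moreover have "w 0 = F x" "w N = F y" using N(1) L by (auto simp: w_def z_def \<sigma>0 min_def)
    ultimately show ?thesis by (simp add: dist_norm norm_minus_commute)
  qed
  then show ?thesis by (intro exI[of _ "real R"] ballI impI)
qed

theorem theorem1p7:
  fixes D :: "(complex ^ 'k) set" and \<Omega> :: "(complex ^ 'd) set"
    and F :: "complex ^ 'k \<Rightarrow> complex ^ 'd"
  assumes "bounded_domain D"
    and "Metric_space D (kobayashi_dist D)"
    and "proper_space D (kobayashi_dist D)"
    and "geodesic_space D (kobayashi_dist D)"
    and "gromov_hyperbolic D (kobayashi_dist D)"
    and "goldilocks_domain \<Omega>"
    and "continuous_map (Metric_space.mtopology D (kobayashi_dist D))
           (Metric_space.mtopology \<Omega> (kobayashi_dist \<Omega>)) F"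
    and "quasi_isometric_embedding D (kobayashi_dist D) \<Omega> (kobayashi_dist \<Omega>) F"
  shows "\<exists>F' :: complex ^ 'k + (nat \<Rightarrow> complex ^ 'k) set \<Rightarrow> complex ^ 'd.
           continuous_map (gromov_compactification D (kobayashi_dist D))
             (top_of_set (closure \<Omega>)) F' \<and>
           (\<forall>x\<in>D. F' (Inl x) = F x)"
proof -
  have dom: "bounded_domain \<Omega>" using assms(6) by (simp add: goldilocks_domain_def)
  have im: "F ` D \<subseteq> \<Omega>" using assms(8) by (simp add: quasi_isometric_embedding_def)
  have "continuous_map (Metric_space.mtopology D (kobayashi_dist D)) euclidean F"
    using continuous_map_compose[OF assms(7) continuous_map_kobayashi_euclidean[OF dom]]
    by (simp add: o_def)
  then show ?thesis
    by (rule gromov_extension[OF assms(2) _ im goldilocks_visibility[OF assms(2,4,6,8)]])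
qed

end
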